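(* Let $N\geq3$ be an integer, fix parameters $r\geq0$, $Q>0$, $\lambda_1,\ldots,\lambda_r>0$, $\mu_1,\ldots,\mu_r\in\mathbb{C}$ with $\operatorname{Re}\mu_j\geq0$, and let $F_1(s),\ldots,F_N(s)$ be functions satisfying (I), (II), (IV), and (V) with these parameters and with root numbers $\omega_1,\ldots,\omega_N$, $|\omega_j|=1$. Suppose that $\omega_h\neq\omega_k$ for some $h,k\in\{1,\ldots,N\}$. Then there exist infinitely many $\mathbf{c}=(c_1,\ldots,c_N)\in\mathbb{C}^N$ such that $L_{\mathbf{c}}(s)=\sum_{j=1}^N c_jF_j(s)$ satisfies (IV) and (V) (with the same parameters $r,Q,\lambda_j,\mu_j$ and some $\omega$ with $|\omega|=1$) and has no zeros in some vertical strip $\sigma_1<\sigma<\sigma_2$ with $1<\sigma_1<\sigma_2<\sigma^*(L_{\mathbf{c}})$.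
   Context: Write $s=\sigma+it$. Conditions on a complex function $F(s)$: (I) $F(s)=\sum_{n=1}^\infty a_F(n)n^{-s}$ is absolutely convergent for $\sigma>1$; (II) $\log F(s)=\sum_p\sum_{k=1}^\infty b_F(p^k)p^{-ks}$ (sum over primes) is absolutely convergent for $\sigma>1$, with $|b_F(p^k)|\ll p^{k\theta}$ for all primes $p$, $k\geq1$, for some $\theta<\frac12$; (IV) $(s-1)^mF(s)$ extends to an entire function of finite order for some integer $m\geq0$; (V) with $\Phi(s)=Q^s\prod_{j=1}^r\Gamma(\lambda_js+\mu_j)F(s)$, one has $\Phi(s)=\omega\,\overline{\Phi(1-\overline{s})}$ for some $\omega$ with $|\omega|=1$. $\sigma^*(L)$ is the least upper bound of the real parts of the zeros of $L(s)$ in its half-plane of absolute convergence.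
   Formalization: The functions F_1,…,F_N are assumed pairwise distinct on σ>1; with repetitions the claim can fail, e.g. N=3, F_1=F_2=L(s,χ), F_3=L(s,χ̄) with χ odd of order 4 mod 5. *)

theory Defs
  imports
    "HOL-Complex_Analysis.Complex_Analysis"
    "HOL-Computational_Algebra.Primes"
begin

text \<open>
  A function \<open>F :: complex \<Rightarrow> complex\<close> stands for the analytic continuation of a Dirichlet series
  to the plane punctured at \<open>s = 1\<close>. The value \<open>F 1\<close> is unconstrained, and nothing below
  depends on it. Dirichlet coefficients are indexed by \<open>{1..}\<close>; \<open>a 0\<close> is never used.
\<close>

definition dirichlet_term :: "(nat \<Rightarrow> complex) \<Rightarrow> complex \<Rightarrow> nat \<Rightarrow> complex" where
  "dirichlet_term a s n = a n * of_nat n powr (- s)"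

definition dirichlet_abs_conv :: "(nat \<Rightarrow> complex) \<Rightarrow> complex \<Rightarrow> bool" where
  "dirichlet_abs_conv a s \<longleftrightarrow> (\<lambda>n. norm (dirichlet_term a s n)) summable_on {1..}"

definition dirichlet_series :: "(nat \<Rightarrow> complex) \<Rightarrow> complex \<Rightarrow> complex" where
  "dirichlet_series a s = infsum (dirichlet_term a s) {1..}"

definition cond_I :: "(complex \<Rightarrow> complex) \<Rightarrow> (nat \<Rightarrow> complex) \<Rightarrow> bool" where
  "cond_I F a \<longleftrightarrow>
     (\<forall>s. Re s > 1 \<longrightarrow> dirichlet_abs_conv a s \<and> F s = dirichlet_series a s)"

text \<open>
  Here \<open>l\<close> is the holomorphic branch of the logarithm of \<open>F\<close> given by the sum over prime
  powers. It is the branch that tends to 0 as the real part of \<open>s\<close> tends to infinity, because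
  the series does.
\<close>

definition cond_II :: "(complex \<Rightarrow> complex) \<Rightarrow> bool" where
  "cond_II F \<longleftrightarrow>
     (\<exists>(l :: complex \<Rightarrow> complex) (b :: nat \<Rightarrow> complex).
        l holomorphic_on {s. Re s > 1} \<and>
        (\<forall>s. Re s > 1 \<longrightarrow>
           exp (l s) = F s \<and>
           (\<lambda>(p, k). norm (b (p ^ k) * of_nat p powr (- (of_nat k * s))))
              summable_on ({p. prime p} \<times> {1..}) \<and>
           l s = (\<Sum>\<^sub>\<infinity>(p, k)\<in>{p. prime p} \<times> {1..}.
                    b (p ^ k) * of_nat p powr (- (of_nat k * s)))) \<and>
        (\<exists>\<theta> C :: real. \<theta> < 1 / 2 \<and>
           (\<forall>p k. prime p \<longrightarrow> k \<ge> 1 \<longrightarrow> norm (b (p ^ k)) \<le> C * real p powr (real k * \<theta>))))"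

definition entire_finite_order :: "(complex \<Rightarrow> complex) \<Rightarrow> bool" where
  "entire_finite_order G \<longleftrightarrow>
     G holomorphic_on UNIV \<and> (\<exists>A C :: real. \<forall>s. norm (G s) \<le> C * exp (norm s powr A))"

definition cond_IV :: "(complex \<Rightarrow> complex) \<Rightarrow> bool" where
  "cond_IV F \<longleftrightarrow>
     (\<exists>(m :: nat) G. entire_finite_order G \<and> (\<forall>s. s \<noteq> 1 \<longrightarrow> G s = (s - 1) ^ m * F s))"

definition completed ::
  "nat \<Rightarrow> real \<Rightarrow> (nat \<Rightarrow> real) \<Rightarrow> (nat \<Rightarrow> complex) \<Rightarrow> (complex \<Rightarrow> complex) \<Rightarrow> complex \<Rightarrow> complex" where
  "completed r Q lam mu F s =
     of_real Q powr s * (\<Prod>j=1..r. Gamma (of_real (lam j) * s + mu j)) * F s"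

text \<open>
  The library's \<open>Gamma\<close> takes the value 0 at its poles, so an identity between meromorphic
  functions has to be stated away from the (discrete) set of possible singularities of the
  two sides.
\<close>

definition completed_regular_at ::
  "nat \<Rightarrow> (nat \<Rightarrow> real) \<Rightarrow> (nat \<Rightarrow> complex) \<Rightarrow> complex \<Rightarrow> bool" where
  "completed_regular_at r lam mu s \<longleftrightarrow>
     s \<noteq> 1 \<and> (\<forall>j\<in>{1..r}. of_real (lam j) * s + mu j \<notin> \<int>\<^sub>\<le>\<^sub>0)"

definition cond_V ::
  "nat \<Rightarrow> real \<Rightarrow> (nat \<Rightarrow> real) \<Rightarrow> (nat \<Rightarrow> complex) \<Rightarrow> complex \<Rightarrow> (complex \<Rightarrow> complex) \<Rightarrow> bool" where
  "cond_V r Q lam mu \<omega> F \<longleftrightarrow>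
     norm \<omega> = 1 \<and>
     (\<forall>s. completed_regular_at r lam mu s \<and> completed_regular_at r lam mu (1 - cnj s) \<longrightarrow>
        completed r Q lam mu F s = \<omega> * cnj (completed r Q lam mu F (1 - cnj s)))"

definition abs_conv_abscissa :: "(nat \<Rightarrow> complex) \<Rightarrow> ereal" where
  "abs_conv_abscissa a = Inf {ereal \<sigma> | \<sigma>. dirichlet_abs_conv a (of_real \<sigma>)}"

text \<open>
  The supremum is taken in the extended reals: it is \<open>-\<infinity>\<close> if there are no zeros in the
  half-plane of absolute convergence.
\<close>

definition sigma_star :: "(nat \<Rightarrow> complex) \<Rightarrow> ereal" where
  "sigma_star a =
     Sup {ereal (Re s) | s. abs_conv_abscissa a < ereal (Re s) \<and> dirichlet_series a s = 0}"

definition lincomb :: "complex ^ 'n \<Rightarrow> ('n \<Rightarrow> 'b \<Rightarrow> complex) \<Rightarrow> 'b \<Rightarrow> complex" where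
  "lincomb c f x = (\<Sum>j\<in>UNIV. c $ j * f j x)"

end

theory Submission
  imports Defs
begin

text \<open>
  Choose unimodular \<open>\<eta>\<^sub>j\<close> with \<open>\<eta>\<^sub>j\<^sup>2 \<omega>\<^sub>j = 1\<close>. Every combination whose coefficients are real multiples
  \<open>c\<^sub>j = x\<^sub>j \<eta>\<^sub>j\<close> satisfies (V) with root number 1. If \<open>\<omega>\<^sub>h \<noteq> \<omega>\<^sub>k\<close> then \<open>\<eta>\<^sub>h, \<eta>\<^sub>k\<close> span the plane over
  the reals, so with a third index such \<open>c\<close> can be chosen nonzero with \<open>\<Sum> c\<^sub>j = 0\<close>. Then the constant
  term of the Dirichlet series of \<open>L\<^sub>c\<close> vanishes, so that \<open>L\<^sub>c(s) = A q\<^sup>-\<^sup>s + o(q\<^sup>-\<^sup>\<sigma>)\<close> with \<open>q \<ge> 2\<close>, and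
  \<open>L\<^sub>c\<close> has no zeros far to the right. Adding \<open>\<delta> \<eta>\<^sub>h\<close> to \<open>c\<^sub>h\<close> for a small real \<open>\<delta> > 0\<close> leaves a fixed
  strip free of zeros but creates zeros near the solutions of \<open>A q\<^sup>-\<^sup>s = - \<delta> \<eta>\<^sub>h\<close>, which lie to the right
  of that strip.

  It has to be excluded that \<open>L\<^sub>c\<close> vanishes identically. By Kronecker's theorem, vertical shifts of the
  Euler products approximate a twist of a single local factor, so a relation \<open>F\<^sub>3 = \<alpha> F\<^sub>1 + \<beta> F\<^sub>2\<close>
  persists when the variable \<open>p\<^sup>-\<^sup>s\<close> in the factors at \<open>p\<close> is replaced by a free variable \<open>z\<close>. This
  forces \<open>F\<^sub>1\<close> and \<open>F\<^sub>2\<close> to differ at one prime only: \<open>F\<^sub>1(s) = A(p\<^sup>-\<^sup>s) F\<^sub>2(s)\<close>. Since \<open>\<theta> < 1/2\<close>, the function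
  \<open>A\<close> is holomorphic in a disc of radius greater than \<open>p\<^sup>-\<^sup>1\<^sup>/\<^sup>2\<close>. The functional equations make a constant
  multiple of \<open>A\<close> real on the circle of radius \<open>p\<^sup>-\<^sup>1\<^sup>/\<^sup>2\<close>, so \<open>A = 1\<close>.
\<close>

section \<open>Kronecker approximation for the powers of the primes\<close>

text \<open>Dominated convergence for sums: the majorant \<open>M\<close> makes the finite partial
  sums converge uniformly in \<open>n\<close>, so the two limits may be exchanged.\<close>

lemma tendsto_infsum_dominated:
  fixes f :: "nat \<Rightarrow> 'a \<Rightarrow> complex"
  assumes lim: "\<And>x. x \<in> A \<Longrightarrow> (\<lambda>n. f n x) \<longlonglongrightarrow> g x"
    and bound: "\<And>n x. x \<in> A \<Longrightarrow> norm (f n x) \<le> M x"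
    and M: "M summable_on A"
  shows "(\<lambda>n. infsum (f n) A) \<longlonglongrightarrow> infsum g A"
proof -
  have gb: "norm (g x) \<le> M x" if "x \<in> A" for x
    by (rule Lim_bounded[OF tendsto_norm[OF lim[OF that]], of 0]) (use bound that in auto)
  have gs: "(\<lambda>x. norm (g x)) summable_on A"
    by (rule summable_on_comparison_test[OF M gb]) auto
  have u: "uniform_limit UNIV (\<lambda>X n. \<Sum>x\<in>X. f n x) (\<lambda>n. infsum (f n) A) (finite_subsets_at_top A)"
    by (rule Weierstrass_m_test_general[OF bound M])
  show ?thesis
  proof (rule swap_uniform_limit'[OF _ _ u])
    show "\<forall>\<^sub>F X in finite_subsets_at_top A. ((\<lambda>n. \<Sum>x\<in>X. f n x) \<longlongrightarrow> (\<Sum>x\<in>X. g x)) sequentially"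
      by (rule eventually_finite_subsets_at_top_weakI) (auto intro!: tendsto_sum lim)
    show "((\<lambda>X. \<Sum>x\<in>X. g x) \<longlongrightarrow> infsum g A) (finite_subsets_at_top A)"
      by (rule infsum_tendsto[OF abs_summable_summable[OF gs]])
  qed auto
qed

text \<open>Unique factorisation: moving the negative terms across and exponentiating gives
  \<open>A = B\<close>, where \<open>A\<close> and \<open>B\<close> are products over disjoint sets
  of primes. A prime with nonzero coefficient would divide exactly one of them.\<close>

lemma sum_ln_primes_eq_0_imp:
  fixes u :: "nat \<Rightarrow> int"
  assumes fin: "finite T" and pr: "\<And>p. p \<in> T \<Longrightarrow> prime p"
    and sum0: "(\<Sum>p\<in>T. of_int (u p) * ln (real p)) = 0" and "p \<in> T"
  shows "u p = 0"
proof -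
  define A where "A = (\<Prod>p\<in>{p\<in>T. u p > 0}. p ^ nat (u p))"
  define B where "B = (\<Prod>p\<in>{p\<in>T. u p < 0}. p ^ nat (- u p))"
  have pos: "p > 0" if "p \<in> T" for p
    using pr[OF that] prime_gt_0_nat by blast
  have "A > 0" "B > 0"
    unfolding A_def B_def using pos by (auto intro!: prod_pos)
  have lnA: "ln (real A) = (\<Sum>p\<in>{p\<in>T. u p > 0}. of_int (u p) * ln (real p))"
    unfolding A_def of_nat_prod using fin pos
    by (subst ln_prod) (auto simp: ln_realpow intro!: sum.cong)
  have lnB: "ln (real B) = (\<Sum>p\<in>{p\<in>T. u p < 0}. - of_int (u p) * ln (real p))"
    unfolding B_def of_nat_prod using fin pos
    by (subst ln_prod) (auto simp: ln_realpow intro!: sum.cong)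
  have "(\<Sum>p\<in>T. of_int (u p) * ln (real p)) =
      (\<Sum>p\<in>{p\<in>T. u p > 0} \<union> {p\<in>T. u p < 0}. of_int (u p) * ln (real p))"
    by (rule sum.mono_neutral_right) (use fin in auto)
  also have "\<dots> = ln (real A) - ln (real B)"
    unfolding lnA lnB by (subst sum.union_disjoint) (use fin in \<open>auto simp: sum_negf\<close>)
  finally have "ln (real A) = ln (real B)"
    using sum0 by simp
  then have "A = B"
    using \<open>A > 0\<close> \<open>B > 0\<close> by simp
  have dA: "p dvd A \<longleftrightarrow> u p > 0" and dB: "p dvd B \<longleftrightarrow> u p < 0"
  proof -
    have eq: "p dvd (\<Prod>q\<in>S. q ^ e q) \<longleftrightarrow> p \<in> S" if "S \<subseteq> T" "\<And>q. q \<in> S \<Longrightarrow> e q > 0" for S and e :: "nat \<Rightarrow> nat"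
    proof -
      have "finite S" using that fin finite_subset by blast
      then have "p dvd (\<Prod>q\<in>S. q ^ e q) \<longleftrightarrow> (\<exists>q\<in>S. p dvd q ^ e q)"
        using pr[OF \<open>p \<in> T\<close>] by (simp add: prime_dvd_prod_iff)
      also have "\<dots> \<longleftrightarrow> (\<exists>q\<in>S. p = q)"
      proof (rule bex_cong[OF refl])
        fix q assume "q \<in> S"
        then have "prime q" "e q > 0" using that pr by auto
        then show "p dvd q ^ e q \<longleftrightarrow> p = q"
          using pr[OF \<open>p \<in> T\<close>] by (metis dvd_refl prime_dvd_power_nat_iff primes_dvd_imp_eq)
      qed
      finally show ?thesis by auto
    qed
    show "p dvd A \<longleftrightarrow> u p > 0" "p dvd B \<longleftrightarrow> u p < 0"
      unfolding A_def B_def using \<open>p \<in> T\<close> by (subst eq; auto)+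
  qed
  with \<open>A = B\<close> show ?thesis by fastforce
qed

lemma dist_exp_ii_le: "norm (exp (\<i> * of_real x) - exp (\<i> * of_real y)) \<le> \<bar>x - y\<bar>" for x y :: real
proof -
  have "exp (\<i> * of_real x) - exp (\<i> * of_real y) =
      exp (\<i> * of_real y) * (exp (\<i> * of_real (x - y)) - 1)"
    by (simp add: algebra_simps exp_diff)
  then show ?thesis
    using dist_exp_i_1[of "x - y"] abs_sin_le_one abs_sin_x_le_abs_x[of "(x - y) / 2"]
    by (simp add: norm_mult)
qed

text \<open>The logarithms of the primes are linearly independent over the integers, so Kronecker's
  theorem brings all \<open>t * \<theta> i\<close> simultaneously close, modulo 1, to the arguments
  of the \<open>z p\<close> divided by \<open>2 * pi\<close>. A chord is at most its arc, whence the
  tolerance \<open>\<epsilon> / (2 * pi)\<close>.\<close>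

lemma Kronecker_primes_finite:
  fixes z :: "nat \<Rightarrow> complex"
  assumes fin: "finite S" and pr: "\<And>p. p \<in> S \<Longrightarrow> prime p"
    and z: "\<And>p. p \<in> S \<Longrightarrow> norm (z p) = 1" and "\<epsilon> > 0"
  obtains t :: real where "\<And>p. p \<in> S \<Longrightarrow> norm (of_nat p powr (- (\<i> * of_real t)) - z p) < \<epsilon>"
proof -
  obtain h where h: "bij_betw h {..<card S} S"
    using ex_bij_betw_nat_finite[OF fin] by (auto simp: atLeast0LessThan)
  have hS: "h i \<in> S" if "i < card S" for i
    using h that by (auto simp: bij_betw_def)
  define \<theta> where "\<theta> i = - ln (real (h i)) / (2 * pi)" for i
  define \<alpha> where "\<alpha> i = Arg (z (h i)) / (2 * pi)" for i
  \<comment> \<open>The reals as a module over the integers, so that \<open>dependent\<close> means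
    an integer relation.\<close>
  interpret Modules.module "(\<lambda>r. (*) (real_of_int r))"
    by (simp add: Modules.module.intro distrib_left mult.commute)
  have inj: "inj_on \<theta> {..<card S}"
  proof (rule inj_onI)
    fix i j assume ij: "i \<in> {..<card S}" "j \<in> {..<card S}" and "\<theta> i = \<theta> j"
    then have "ln (real (h i)) = ln (real (h j))"
      by (simp add: \<theta>_def)
    moreover have "h i > 0" "h j > 0"
      using ij hS pr prime_gt_0_nat by auto
    ultimately have "h i = h j" by simp
    with ij h show "i = j" by (auto simp: bij_betw_def inj_on_def)
  qed
  have dep: False if "dependent (\<theta> ` {..<card S})"
  proof -
    from iffD1[OF dependent_explicit that] obtain T u where
      "finite T \<and> T \<subseteq> \<theta> ` {..<card S} \<and> (\<Sum>v\<in>T. of_int (u v) * v) = 0 \<and> (\<exists>v\<in>T. u v \<noteq> 0)"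
      by (elim exE)
    then obtain v where T: "T \<subseteq> \<theta> ` {..<card S}" "(\<Sum>v\<in>T. of_int (u v) * v) = 0"
        "v \<in> T" "u v \<noteq> 0"
      by (elim conjE bexE)
    then obtain I where I: "I \<subseteq> {..<card S}" "T = \<theta> ` I"
      using subset_imageE[OF T(1)] by metis
    have injI: "inj_on \<theta> I" and hI: "inj_on h I"
      using I inj h by (auto simp: bij_betw_def intro: inj_on_subset)
    define g where "g p = the_inv_into I h p" for p
    have gh: "g (h i) = i" if "i \<in> I" for i
      unfolding g_def using hI that by (rule the_inv_into_f_f)
    have "(\<Sum>p\<in>h ` I. of_int (u (\<theta> (g p))) * ln (real p)) =
        (\<Sum>i\<in>I. of_int (u (\<theta> i)) * ln (real (h i)))"
      by (subst sum.reindex[OF hI]) (auto simp: gh)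
    also have "\<dots> = - (2 * pi) * (\<Sum>v\<in>T. of_int (u v) * v)"
      unfolding I(2) by (subst sum.reindex[OF injI]) (auto simp: sum_distrib_left \<theta>_def intro!: sum.cong)
    finally have eq: "(\<Sum>p\<in>h ` I. of_int (u (\<theta> (g p))) * ln (real p)) = 0"
      using T by simp
    obtain i where i: "i \<in> I" "v = \<theta> i"
      using T(3) I(2) by blast
    have "u (\<theta> (g (h i))) = 0"
      by (rule sum_ln_primes_eq_0_imp[OF _ _ eq])
        (use i I hS pr in \<open>auto intro: finite_subset\<close>)
    with i T(4) gh show False by simp
  qed
  have "\<epsilon> / (2 * pi) > 0" using \<open>\<epsilon> > 0\<close> by simp
  then obtain t k where tk: "\<And>i. i < card S \<Longrightarrow> \<bar>t * \<theta> i - of_int (k i) - \<alpha> i\<bar> < \<epsilon> / (2 * pi)"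
    using Kronecker_thm_1[of \<theta> "card S" "\<epsilon> / (2 * pi)" \<alpha>] dep inj by blast
  show thesis
  proof (rule that[of t])
    fix p assume "p \<in> S"
    then obtain i where i: "i < card S" "p = h i"
      using h by (auto simp: bij_betw_def)
    have "p > 0" using pr[OF \<open>p \<in> S\<close>] prime_gt_0_nat by blast
    have zp: "z p = exp (\<i> * of_real (2 * pi * \<alpha> i))"
    proof -
      have "z p \<noteq> 0" using z[OF \<open>p \<in> S\<close>] by auto
      then show ?thesis
        using Arg_eq[of "z p"] z[OF \<open>p \<in> S\<close>] i by (simp add: \<alpha>_def)
    qed
    have "- (\<i> * of_real t) * ln (of_nat p) = \<i> * of_real (2 * pi * (t * \<theta> i))"
      using \<open>p > 0\<close> by (simp add: \<theta>_def i Ln_of_nat)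
    then have "of_nat p powr (- (\<i> * of_real t)) = exp (\<i> * of_real (2 * pi * (t * \<theta> i)))"
      using \<open>p > 0\<close> unfolding powr_def by auto
    also have "\<dots> = exp (\<i> * of_real (2 * pi * (t * \<theta> i - of_int (k i))))"
      unfolding exp_eq by (rule exI[of _ "k i"]) (simp add: algebra_simps)
    finally have "norm (of_nat p powr (- (\<i> * of_real t)) - z p) \<le>
        \<bar>2 * pi * (t * \<theta> i - of_int (k i)) - 2 * pi * \<alpha> i\<bar>"
      unfolding zp using dist_exp_ii_le by metis
    also have "\<dots> = 2 * pi * \<bar>t * \<theta> i - of_int (k i) - \<alpha> i\<bar>"
      by (simp add: abs_mult flip: right_diff_distrib)
    also have "\<dots> < \<epsilon>"
      using tk[OF i(1)] by (simp add: field_simps)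
    finally show "norm (of_nat p powr (- (\<i> * of_real t)) - z p) < \<epsilon>" .
  qed
qed

text \<open>A diagonal choice: \<open>t n\<close> serves all primes up to \<open>n\<close> with
  error below \<open>1 / (n + 1)\<close>, so for each fixed prime only finitely many
  \<open>n\<close> are lost.\<close>

lemma Kronecker_primes:
  fixes z :: "nat \<Rightarrow> complex"
  assumes z: "\<And>p. prime p \<Longrightarrow> norm (z p) = 1"
  obtains t :: "nat \<Rightarrow> real"
  where "\<And>p. prime p \<Longrightarrow> (\<lambda>n. of_nat p powr (- (\<i> * of_real (t n)))) \<longlonglongrightarrow> z p"
proof -
  have "\<exists>t::real. \<forall>p\<in>{p. prime p \<and> p \<le> n}. norm (of_nat p powr (- (\<i> * of_real t)) - z p) < 1 / real (Suc n)"
    for n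
    by (rule Kronecker_primes_finite[of "{p. prime p \<and> p \<le> n}" z "1 / real (Suc n)"])
      (use z in \<open>auto intro: finite_subset[of _ "{..n}"]\<close>)
  then obtain t :: "nat \<Rightarrow> real" where
    t: "\<And>n p. prime p \<Longrightarrow> p \<le> n \<Longrightarrow> norm (of_nat p powr (- (\<i> * of_real (t n))) - z p) < 1 / real (Suc n)"
    by (metis (no_types, lifting) mem_Collect_eq)
  show thesis
  proof (rule that[of t])
    fix p :: nat assume p: "prime p"
    have "(\<lambda>n. of_nat p powr (- (\<i> * of_real (t n))) - z p) \<longlonglongrightarrow> 0"
      by (rule Lim_null_comparison[OF _ LIMSEQ_Suc[OF lim_1_over_n]])
        (use t[OF p] in \<open>auto intro!: eventually_sequentiallyI[of p] less_imp_le\<close>)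
    then show "(\<lambda>n. of_nat p powr (- (\<i> * of_real (t n)))) \<longlonglongrightarrow> z p"
      by (simp add: LIM_zero_iff)
  qed
qed

section \<open>Dirichlet series far to the right\<close>

lemma dirichlet_abs_conv_iff:
  "dirichlet_abs_conv a s \<longleftrightarrow> (\<lambda>n. norm (a n) * real n powr (- Re s)) summable_on {1..}"
  unfolding dirichlet_abs_conv_def
  by (rule summable_on_cong) (auto simp: dirichlet_term_def norm_mult norm_powr_real_powr)

text \<open>For \<open>n > N\<close> the power \<open>n powr (- Re s)\<close> is at most
  \<open>(N + 1) powr (\<sigma>0 - Re s) * n powr (- \<sigma>0)\<close>. The tail at
  \<open>\<sigma>0\<close> thus controls all tails further right, uniformly in the imaginary
  part.\<close>

lemma dirichlet_series_leading_term:
  assumes conv: "dirichlet_abs_conv a (of_real \<sigma>0)" and "N \<ge> 1"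
    and zero: "\<And>n. 1 \<le> n \<Longrightarrow> n < N \<Longrightarrow> a n = 0"
  obtains K where "K \<ge> 0"
    "\<And>s. Re s \<ge> \<sigma>0 \<Longrightarrow> norm (dirichlet_series a s - a N * of_nat N powr (- s)) \<le> K * real (N + 1) powr (- Re s)"
proof -
  define M where "M n = norm (a n) * real n powr (- \<sigma>0)" for n
  have M: "M summable_on {1..}"
    using conv unfolding dirichlet_abs_conv_iff M_def by simp
  define K where "K = real (N + 1) powr \<sigma>0 * infsum M {N+1..}"
  have MN: "M summable_on {N+1..}"
    by (rule summable_on_subset_banach[OF M]) auto
  show thesis
  proof (rule that[of K])
    show "K \<ge> 0"
      unfolding K_def by (intro mult_nonneg_nonneg infsum_nonneg) (auto simp: M_def)
    fix s assume s: "Re s \<ge> \<sigma>0"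
    define d where "d = real (N + 1) powr (\<sigma>0 - Re s)"
    have sm: "(\<lambda>n. d * M n) summable_on {N+1..}"
      by (rule summable_on_cmult_right[OF MN])
    have bd: "norm (dirichlet_term a s n) \<le> d * M n" if "n \<in> {N+1..}" for n
    proof -
      have n: "n \<ge> N + 1" using that by simp
      have "real n powr (- Re s) = real n powr (\<sigma>0 - Re s) * real n powr (- \<sigma>0)"
        by (simp flip: powr_add)
      also have "\<dots> \<le> d * real n powr (- \<sigma>0)"
        unfolding d_def using n s \<open>N \<ge> 1\<close> by (intro mult_right_mono powr_mono2') auto
      finally have "norm (a n) * real n powr (- Re s) \<le> norm (a n) * (d * real n powr (- \<sigma>0))"
        by (intro mult_left_mono) auto
      then show ?thesis
        using n by (simp add: dirichlet_term_def norm_mult norm_powr_real_powr M_def mult_ac)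
    qed
    have abs: "(\<lambda>n. norm (dirichlet_term a s n)) summable_on {N+1..}"
      by (rule summable_on_comparison_test[OF sm bd]) auto
    have "dirichlet_series a s = infsum (dirichlet_term a s) {N..}"
      unfolding dirichlet_series_def
      by (rule infsum_cong_neutral) (use zero \<open>N \<ge> 1\<close> in \<open>auto simp: dirichlet_term_def\<close>)
    also have "{N..} = insert N {N+1..}" by auto
    also have "infsum (dirichlet_term a s) (insert N {N+1..}) =
        infsum (dirichlet_term a s) {N+1..} + dirichlet_term a s N"
      using infsum_Un_disjoint[of "dirichlet_term a s" "{N}" "{N+1..}"] abs_summable_summable[OF abs]
      by simp
    finally have "norm (dirichlet_series a s - a N * of_nat N powr (- s)) =
        norm (infsum (dirichlet_term a s) {N+1..})"
      by (simp add: dirichlet_term_def)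
    also have "\<dots> \<le> infsum (\<lambda>n. norm (dirichlet_term a s n)) {N+1..}"
      by (rule norm_infsum_bound[OF abs])
    also have "\<dots> \<le> infsum (\<lambda>n. d * M n) {N+1..}"
      by (rule infsum_mono[OF abs sm bd])
    also have "\<dots> = d * infsum M {N+1..}"
      by (rule infsum_cmult_right) (use MN in auto)
    also have "\<dots> = K * real (N + 1) powr (- Re s)"
      by (simp add: d_def K_def powr_diff powr_minus divide_simps)
    finally show "norm (dirichlet_series a s - a N * of_nat N powr (- s)) \<le> K * real (N + 1) powr (- Re s)" .
  qed
qed

text \<open>Taylor's formula gives \<open>|exp w - 1 - w| <= 3/32\<close>, hence
  \<open>|1 - exp w| >= 1/4 - 3/32 = 5/32\<close>. This bounds the main term from below on the
  circle around the expected zero.\<close>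

lemma norm_one_minus_exp_quarter:
  fixes w :: complex
  assumes "norm w = 1 / 4"
  shows "norm (1 - exp w) \<ge> 3 / 20"
proof -
  have "norm (exp w - (\<Sum>k\<le>1. w ^ k / fact k)) \<le> exp \<bar>Re w\<bar> * norm w ^ Suc 1 / fact 1"
    by (rule Taylor_exp)
  also have "(\<Sum>k\<le>1. w ^ k / fact k) = 1 + w"
    by simp
  also have "exp \<bar>Re w\<bar> \<le> 3 / 2"
  proof -
    have "exp \<bar>Re w\<bar> \<le> exp (1 / 4)"
      using abs_Re_le_cmod[of w] assms by simp
    also have "exp (1 / 4 :: real) \<le> 3 / 2"
      using exp_bound[of "1 / 4"] by (simp add: power2_eq_square)
    finally show ?thesis .
  qed
  finally have "norm (exp w - (1 + w)) \<le> 3 / 32"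
    using assms by (simp add: power2_eq_square)
  moreover have "norm w \<le> norm (exp w - (1 + w)) + norm (1 - exp w)"
    using norm_triangle_ineq[of "exp w - (1 + w)" "1 - exp w"] by simp
  ultimately show ?thesis using assms by simp
qed

lemma powr_at_top_tendsto_0:
  fixes c :: real
  assumes "0 < c" "c < 1"
  shows "((\<lambda>x. c powr x) \<longlongrightarrow> 0) at_top"
proof -
  have "filterlim (\<lambda>x. ln c * x) at_bot at_top"
    by (rule filterlim_tendsto_neg_mult_at_bot[OF tendsto_const _ filterlim_ident]) (use assms in auto)
  then have "((\<lambda>x. exp (ln c * x)) \<longlongrightarrow> 0) at_top"
    by (rule filterlim_compose[OF exp_at_bot])
  then show ?thesis
    using assms by (simp add: powr_def mult.commute)
qed

text \<open>
  On the circle of radius \<open>1 / (4 ln q)\<close> about a solution \<open>w\<close> of \<open>A q\<^sup>-\<^sup>w = - e\<close>, the main term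
  \<open>A q\<^sup>-\<^sup>s + e\<close> has modulus at least \<open>3 |e| / 20\<close>, whereas the error is at most \<open>|e| / 20\<close>.
\<close>

lemma perturbed_zero_free_strip_and_zero:
  fixes f g :: "complex \<Rightarrow> complex"
  assumes A: "A \<noteq> 0" and q: "q \<ge> (2::nat)" and K: "K \<ge> 0"
    and f: "\<And>s. Re s \<ge> 2 \<Longrightarrow> norm (f s - A * of_nat q powr (- s)) \<le> K * real (q + 1) powr (- Re s)"
    and g: "\<And>s. Re s \<ge> 2 \<Longrightarrow> norm (g s - 1) \<le> K * 2 powr (- Re s)"
    and hf: "f holomorphic_on {s. Re s > 1}" and hg: "g holomorphic_on {s. Re s > 1}"
  obtains \<sigma>1 \<sigma>2 \<delta>0 where "1 < \<sigma>1" "\<sigma>1 < \<sigma>2" "\<delta>0 > 0"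
    "\<And>(e::complex) s. 0 < norm e \<Longrightarrow> norm e < \<delta>0 \<Longrightarrow> \<sigma>1 < Re s \<Longrightarrow> Re s < \<sigma>2 \<Longrightarrow> f s + e * g s \<noteq> 0"
    "\<And>(e::complex). 0 < norm e \<Longrightarrow> norm e < \<delta>0 \<Longrightarrow> \<exists>s. Re s > \<sigma>2 \<and> f s + e * g s = 0"
proof -
  have lq: "ln (real q) > 0" using q by simp
  have lim1: "((\<lambda>\<sigma>. K * (real q / real (q + 1)) powr \<sigma>) \<longlongrightarrow> K * 0) at_top"
    by (intro tendsto_mult tendsto_const powr_at_top_tendsto_0) (use q in auto)
  have lim2: "((\<lambda>\<sigma>. K * (1 / 2 :: real) powr \<sigma>) \<longlongrightarrow> K * 0) at_top"
    by (intro tendsto_mult tendsto_const powr_at_top_tendsto_0) auto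
  have "\<forall>\<^sub>F \<sigma> in at_top. K * (real q / real (q + 1)) powr \<sigma> < norm A / 60 \<and> K * (1 / 2) powr \<sigma> < 1 / 60"
    using order_tendstoD(2)[OF lim1, of "norm A / 60"] order_tendstoD(2)[OF lim2, of "1 / 60"] A
    by (auto elim: eventually_elim2)
  \<comment> \<open>The constants 1/60 fit the later estimate: where \<open>q powr (- Re s)\<close>
    is at most \<open>3/2 * |e| / |A|\<close>, the two errors add up to \<open>|e| / 24\<close>,
    below \<open>|e| / 20\<close>.\<close>
  then obtain T0 where T0: "\<And>\<sigma>. \<sigma> \<ge> T0 \<Longrightarrow> K * (real q / real (q + 1)) powr \<sigma> < norm A / 60"
      "\<And>\<sigma>. \<sigma> \<ge> T0 \<Longrightarrow> K * (1 / 2) powr \<sigma> < 1 / 60"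
    unfolding eventually_at_top_linorder by blast
  define T where "T = max 2 T0"
  have T: "T \<ge> 2" "T \<ge> T0" by (auto simp: T_def)
  have f': "norm (f s - A * of_nat q powr (- s)) \<le> norm A / 60 * real q powr (- Re s)" if "Re s \<ge> T" for s
  proof -
    have "norm (f s - A * of_nat q powr (- s)) \<le> K * real (q + 1) powr (- Re s)"
      using that T by (intro f) auto
    also have "\<dots> = K * (real q / real (q + 1)) powr Re s * real q powr (- Re s)"
      using q by (simp add: powr_divide powr_minus field_simps)
    also have "\<dots> \<le> norm A / 60 * real q powr (- Re s)"
      using that T T0(1)[of "Re s"] by (intro mult_right_mono) auto
    finally show ?thesis .
  qed
  have g': "norm (g s - 1) \<le> 1 / 60" if "Re s \<ge> T" for s
  proof -
    have "norm (g s - 1) \<le> K * 2 powr (- Re s)"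
      using that T by (intro g) auto
    also have "\<dots> = K * (1 / 2) powr (Re s)"
      by (simp add: powr_divide powr_minus field_simps)
    also have "\<dots> \<le> 1 / 60"
      using that T T0(2)[of "Re s"] by auto
    finally show ?thesis .
  qed
  have nq: "norm (of_nat q powr (- s)) = real q powr (- Re s)" for s :: complex
    using q by (simp add: norm_powr_real_powr)
  \<comment> \<open>The factor 1/4 does two jobs: with \<open>|g s| <= 2\<close> it keeps
    \<open>|e * g s|\<close> below half the main term in the strip, and \<open>ln 4 > 1/4\<close>
    places the whole disc of radius \<open>R\<close> about \<open>w\<close> to the right of
    \<open>T + 1\<close>.\<close>
  define \<delta>0 where "\<delta>0 = norm A * real q powr (- (T + 1)) / 4"
  show thesis
  proof (rule that[of T "T + 1" \<delta>0])
    show "1 < T" "T < T + 1" using T by auto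
    show "\<delta>0 > 0" unfolding \<delta>0_def using A q by auto
  next
    fix e s :: complex assume e: "0 < norm e" "norm e < \<delta>0" and s: "T < Re s" "Re s < T + 1"
    have qs: "real q powr (- (T + 1)) \<le> real q powr (- Re s)"
      using q s by (intro powr_mono) auto
    have g2: "norm (g s) \<le> 2"
      using g'[of s] s norm_triangle_sub[of "g s" 1] by simp
    show "f s + e * g s \<noteq> 0"
    proof
      assume "f s + e * g s = 0"
      then have "norm (f s) = norm e * norm (g s)"
        by (metis add_eq_0_iff norm_minus_cancel norm_mult)
      also have "\<dots> \<le> norm e * 2"
        using g2 by (intro mult_left_mono) auto
      also have "\<dots> < \<delta>0 * 2"
        using e by simp
      also have "\<dots> \<le> norm A * real q powr (- Re s) / 2"
        unfolding \<delta>0_def using qs by (simp add: mult_left_mono)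
      finally have fs: "norm (f s) < norm A * real q powr (- Re s) / 2" .
      have "norm A * real q powr (- Re s) = norm (A * of_nat q powr (- s))"
        by (simp add: norm_mult nq)
      also have "\<dots> \<le> norm (f s) + norm (f s - A * of_nat q powr (- s))"
        by (metis add.commute norm_minus_commute norm_triangle_sub)
      also have "\<dots> < norm A * real q powr (- Re s) / 2 + norm A / 60 * real q powr (- Re s)"
        using fs f'[of s] s by simp
      finally have "norm A * real q powr (- Re s) < norm A * real q powr (- Re s) * (1/2 + 1/60)"
        by (simp add: algebra_simps)
      moreover have "norm A * real q powr (- Re s) > 0"
        using A q by simp
      ultimately show False by simp
    qed
  next
    fix e :: complex assume e: "0 < norm e" "norm e < \<delta>0"
    define w where "w = - Ln (- e / A) / of_real (ln (real q))"
    define R where "R = 1 / (4 * ln (real q))"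
    define h where "h s = f s + e * g s" for s
    have R: "R > 0" using lq by (simp add: R_def)
    have qs: "of_nat q powr (- s) = - e / A * exp (- ((s - w) * of_real (ln (real q))))" for s
    proof -
      have "of_nat q powr (- s) = exp (- s * of_real (ln (real q)))"
        using q by (simp add: powr_def Ln_of_nat)
      also have "- s * of_real (ln (real q)) = Ln (- e / A) - (s - w) * of_real (ln (real q))"
        using lq unfolding w_def by (simp add: field_simps)
      also have "exp \<dots> = exp (Ln (- e / A)) * exp (- ((s - w) * of_real (ln (real q))))"
        by (simp add: exp_diff exp_minus divide_simps)
      also have "exp (Ln (- e / A)) = - e / A"
        using e A by (subst exp_Ln) auto
      finally show ?thesis .
    qed
    have Re_w: "Re w - R > T + 1"
    proof -
      have "norm e / norm A < real q powr (- (T + 1)) / 4"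
        using e A unfolding \<delta>0_def by (simp add: field_simps)
      then have "ln (norm e / norm A) < ln (real q powr (- (T + 1)) / 4)"
        using e A q by (subst ln_less_cancel_iff) auto
      also have "\<dots> = - (T + 1) * ln (real q) - ln 4"
        using q by (simp add: ln_div ln_powr)
      finally have le: "ln (norm e / norm A) < - (T + 1) * ln (real q) - ln 4" .
      have ln4: "ln 4 > (1 / 4 :: real)"
      proof -
        have "exp (1 / 4 :: real) < 4"
          using exp_bound[of "1 / 4"] by (simp add: power2_eq_square)
        then show ?thesis
          using ln_less_cancel_iff[of "exp (1/4)" "4::real"] by (simp del: ln_less_cancel_iff)
      qed
      have "- ln (norm e / norm A) - 1 / 4 > (T + 1) * ln (real q)"
        using le ln4 by (simp add: algebra_simps)
      moreover have "Re w = - ln (norm e / norm A) / ln (real q)"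
        unfolding w_def using e A by (simp add: norm_divide)
      ultimately show ?thesis
        unfolding R_def using lq by (simp add: field_simps)
    qed
    have Re_s: "Re s > T + 1" if "norm (s - w) \<le> R" for s
      using abs_Re_le_cmod[of "s - w"] that Re_w by simp
    have est: "norm (h s - e * (1 - exp (- ((s - w) * of_real (ln (real q)))))) \<le> norm e / 20"
      if "norm (s - w) \<le> R" for s
    proof -
      have s: "Re s \<ge> T" using Re_s[OF that] by simp
      define v where "v = - ((s - w) * of_real (ln (real q)))"
      have "norm v = norm (s - w) * ln (real q)"
        unfolding v_def norm_minus_cancel norm_mult using lq by simp
      then have "norm v \<le> 1 / 4"
        using that lq unfolding R_def by (simp add: field_simps)
      have "norm (exp v) \<le> exp (norm v)"
        by (rule norm_exp)
      also have "\<dots> \<le> exp (1 / 4)"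
        using \<open>norm v \<le> 1 / 4\<close> by simp
      also have "\<dots> \<le> 3 / 2"
        using exp_bound[of "1 / 4"] by (simp add: power2_eq_square)
      finally have "norm (exp v) \<le> 3 / 2" .
      then have ql: "real q powr (- Re s) \<le> norm e / norm A * (3 / 2)"
        using nq[of s] qs[of s] A unfolding v_def[symmetric]
        by (metis mult_left_mono norm_divide norm_ge_zero norm_minus_cancel norm_mult)
      have "h s - e * (1 - exp v) = (f s - A * of_nat q powr (- s)) + e * (g s - 1)"
        unfolding h_def qs[of s] v_def[symmetric] using A by (simp add: field_simps)
      also have "norm \<dots> \<le> norm A / 60 * real q powr (- Re s) + norm e * (1 / 60)"
        by (rule order_trans[OF norm_triangle_ineq add_mono[OF f'[OF s]]])
          (unfold norm_mult, rule mult_left_mono[OF g'[OF s] norm_ge_zero])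
      also have "\<dots> \<le> norm A / 60 * (norm e / norm A * (3 / 2)) + norm e * (1 / 60)"
        using ql by (intro add_right_mono mult_left_mono) auto
      also have "\<dots> \<le> norm e / 20"
        using A by (simp add: field_simps)
      finally show ?thesis unfolding v_def .
    qed
    have sub: "cball w R \<subseteq> {s. Re s > 1}"
      using Re_s T by (force simp: dist_norm norm_minus_commute)
    have holh: "h holomorphic_on {s. Re s > 1}"
      unfolding h_def by (intro holomorphic_intros hf hg)
    \<comment> \<open>A minimum modulus argument: \<open>|h w|\<close> is at most
      \<open>|e| / 20\<close>, while on the circle \<open>|h z|\<close> is at least
      \<open>3|e|/20 - |e|/20 = |e|/10\<close>.\<close>
    have "\<exists>z\<in>ball w R. h z = 0"
    proof (rule holomorphic_contract_to_zero[of w R h])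
      show "continuous_on (cball w R) h"
        by (rule holomorphic_on_imp_continuous_on[OF holomorphic_on_subset[OF holh sub]])
      show "h holomorphic_on ball w R"
        by (rule holomorphic_on_subset[OF holh]) (use sub ball_subset_cball in blast)
      show "R > 0" by fact
      fix z assume z: "norm (w - z) = R"
      define v where "v = - ((z - w) * of_real (ln (real q)))"
      have "norm v = norm (w - z) * ln (real q)"
        unfolding v_def norm_minus_cancel norm_mult using lq by (simp add: norm_minus_commute)
      then have "norm v = 1 / 4"
        using z lq unfolding R_def by (simp add: field_simps)
      then have "norm e * norm (1 - exp v) \<ge> norm e * (3 / 20)"
        using norm_one_minus_exp_quarter by (intro mult_left_mono) auto
      moreover have "norm (h z - e * (1 - exp v)) \<le> norm e / 20"
        unfolding v_def by (rule est) (use z in \<open>simp add: norm_minus_commute\<close>)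
      moreover have "norm (e * (1 - exp v)) \<le> norm (h z) + norm (h z - e * (1 - exp v))"
        by (metis add.commute norm_minus_commute norm_triangle_sub)
      ultimately have "norm (h z) \<ge> norm e * (3 / 20) - norm e / 20"
        by (simp add: norm_mult)
      moreover have "norm (h w) \<le> norm e / 20"
        using est[of w] R by simp
      ultimately show "norm (h w) < norm (h z)"
        using e(1) by linarith
    qed blast
    then obtain z where z: "z \<in> ball w R" "h z = 0" by blast
    then show "\<exists>s. Re s > T + 1 \<and> f s + e * g s = 0"
      using Re_s[of z] by (auto simp: h_def dist_norm norm_minus_commute)
  qed
qed

text \<open>Every term tends to 0 because \<open>p ^ k >= 2\<close>, and the series at 2 is a
  majorant for all points \<open>n + 2\<close>.\<close>

lemma prime_power_series_tendsto_0:
  fixes b :: "nat \<Rightarrow> complex"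
  assumes S: "S \<subseteq> {p. prime p}"
    and sm: "(\<lambda>(p, k). norm (b (p ^ k) * of_nat p powr (- (of_nat k * 2)))) summable_on (S \<times> {1..})"
  shows "(\<lambda>n. \<Sum>\<^sub>\<infinity>(p, k)\<in>S \<times> {1..}. b (p ^ k) * of_nat p powr (- (of_nat k * of_nat (n + 2)))) \<longlonglongrightarrow> 0"
proof -
  have "(\<lambda>n. infsum (\<lambda>(p, k). b (p ^ k) * of_nat p powr (- (of_nat k * of_nat (n + 2))))
      (S \<times> {1..})) \<longlonglongrightarrow> infsum (\<lambda>_. 0) (S \<times> {1::nat..})"
  proof (rule tendsto_infsum_dominated[OF _ _ sm], goal_cases)
    case (1 x)
    then obtain p k where x: "x = (p, k)" "prime p" "k \<ge> 1" using S by auto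
    then have p: "p \<ge> 2" using prime_ge_2_nat by blast
    have eq: "of_nat p powr (- (of_nat k * of_nat (n + 2))) = (1 / of_nat p ^ k :: complex) ^ (n + 2)" for n
    proof -
      have m: "of_nat p powr (- of_nat m) = 1 / (of_nat p ^ m :: complex)" for m
        using p by (simp add: powr_minus powr_nat' field_simps)
      have "- (of_nat k * of_nat (n + 2)) = - (of_nat (k * (n + 2)) :: complex)"
        by (simp add: algebra_simps)
      then show ?thesis
        by (simp only: m power_mult power_one_over)
    qed
    have "norm (1 / of_nat p ^ k :: complex) < 1"
      using p x by (simp add: norm_divide norm_power divide_simps one_less_power)
    then have "(\<lambda>n. (1 / of_nat p ^ k :: complex) ^ (n + 2)) \<longlonglongrightarrow> 0"
      by (intro LIMSEQ_ignore_initial_segment LIMSEQ_power_zero)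
    then have "(\<lambda>n. b (p ^ k) * (1 / of_nat p ^ k :: complex) ^ (n + 2)) \<longlonglongrightarrow> b (p ^ k) * 0"
      by (intro tendsto_intros)
    then show ?case
      by (simp only: x eq prod.case mult_zero_right)
  next
    case (2 n x)
    then obtain p k where x: "x = (p, k)" "prime p" "k \<ge> 1" using S by auto
    then have p: "p \<ge> 2" using prime_ge_2_nat by blast
    have "real p powr (- (real k * real (n + 2))) \<le> real p powr (- (real k * 2))"
      using p by (intro powr_mono) (auto intro!: mult_left_mono)
    then show ?case
      using p by (auto simp: x norm_mult norm_powr_real_powr intro!: mult_left_mono)
  qed
  then show ?thesis by simp
qed

section \<open>Conditions (IV) and (V) for linear combinations\<close>

text \<open>A normal form for comparing bounds with different exponents: for
  \<open>norm s >= 2\<close> the power \<open>norm s powr A\<close> increases with \<open>A\<close>,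
  and on the disc of radius 2 continuity gives a bound.\<close>

lemma entire_finite_order_iff:
  "entire_finite_order G \<longleftrightarrow> G holomorphic_on UNIV \<and>
     (\<exists>A C. A \<ge> 1 \<and> C \<ge> 0 \<and> (\<forall>s. norm s \<ge> 2 \<longrightarrow> norm (G s) \<le> C * exp (norm s powr A)))"
proof (intro iffI conjI)
  assume "entire_finite_order G"
  then obtain A C where hol: "G holomorphic_on UNIV" and G: "\<And>s. norm (G s) \<le> C * exp (norm s powr A)"
    unfolding entire_finite_order_def by blast
  show "G holomorphic_on UNIV" by fact
  have "0 \<le> C * exp (norm (0::complex) powr A)"
    using G[of 0] norm_ge_zero order_trans by blast
  then have C: "C \<ge> 0" by (simp add: zero_le_mult_iff)
  have "norm (G s) \<le> C * exp (norm s powr (max A 1))" if "norm s \<ge> 2" for s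
  proof -
    have "norm s powr A \<le> norm s powr (max A 1)"
      using that by (intro powr_mono) auto
    then show ?thesis
      using G[of s] C by (meson exp_le_cancel_iff mult_left_mono order_trans)
  qed
  with C show "\<exists>A C. A \<ge> 1 \<and> C \<ge> 0 \<and> (\<forall>s. norm s \<ge> 2 \<longrightarrow> norm (G s) \<le> C * exp (norm s powr A))"
    by (intro exI[of _ "max A 1"] exI[of _ C]) auto
next
  assume *: "G holomorphic_on UNIV \<and>
     (\<exists>A C. A \<ge> 1 \<and> C \<ge> 0 \<and> (\<forall>s. norm s \<ge> 2 \<longrightarrow> norm (G s) \<le> C * exp (norm s powr A)))"
  then obtain A C where hol: "G holomorphic_on UNIV" and "C \<ge> 0"
    and G: "\<And>s. norm s \<ge> 2 \<Longrightarrow> norm (G s) \<le> C * exp (norm s powr A)"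
    by blast
  have "compact (G ` cball 0 2)"
    by (rule compact_continuous_image[OF holomorphic_on_imp_continuous_on[OF holomorphic_on_subset[OF hol]]]) auto
  then obtain B where B: "\<And>s. norm s \<le> 2 \<Longrightarrow> norm (G s) \<le> B"
    by (meson bounded_iff compact_imp_bounded imageI mem_cball_0)
  have "B \<ge> 0" using B[of 0] norm_ge_zero[of "G 0"] by (simp del: norm_ge_zero)
  have "norm (G s) \<le> (B + C) * exp (norm s powr A)" for s
  proof (cases "norm s \<le> 2")
    case True
    have "norm (G s) \<le> B * 1" using B[OF True] by simp
    also have "\<dots> \<le> (B + C) * exp (norm s powr A)"
      using \<open>B \<ge> 0\<close> \<open>C \<ge> 0\<close> by (intro mult_mono) auto
    finally show ?thesis .
  next
    case False
    then have "norm (G s) \<le> C * exp (norm s powr A)" using G by simp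
    also have "\<dots> \<le> (B + C) * exp (norm s powr A)"
      using \<open>B \<ge> 0\<close> by (intro mult_right_mono) auto
    finally show ?thesis .
  qed
  with hol show "entire_finite_order G"
    unfolding entire_finite_order_def by blast
qed

lemma entire_finite_order_0: "entire_finite_order (\<lambda>_. 0)"
  unfolding entire_finite_order_def by (auto intro!: exI[of _ 0])

lemma entire_finite_order_add:
  assumes "entire_finite_order G" "entire_finite_order H"
  shows "entire_finite_order (\<lambda>s. G s + H s)"
proof -
  obtain A C where G: "G holomorphic_on UNIV" "A \<ge> 1" "C \<ge> 0"
      "\<And>s. norm s \<ge> 2 \<Longrightarrow> norm (G s) \<le> C * exp (norm s powr A)"
    using assms(1) unfolding entire_finite_order_iff by blast
  obtain B D where H: "H holomorphic_on UNIV" "B \<ge> 1" "D \<ge> 0"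
      "\<And>s. norm s \<ge> 2 \<Longrightarrow> norm (H s) \<le> D * exp (norm s powr B)"
    using assms(2) unfolding entire_finite_order_iff by blast
  have "norm (G s + H s) \<le> (C + D) * exp (norm s powr (max A B))" if s: "norm s \<ge> 2" for s
  proof -
    have "norm s powr A \<le> norm s powr (max A B)" "norm s powr B \<le> norm s powr (max A B)"
      using s by (intro powr_mono; simp)+
    then have "C * exp (norm s powr A) \<le> C * exp (norm s powr (max A B))"
        "D * exp (norm s powr B) \<le> D * exp (norm s powr (max A B))"
      using G(3) H(3) by (simp_all add: mult_left_mono)
    with G(4)[OF s] H(4)[OF s] show ?thesis
      by (intro norm_triangle_le) (simp add: algebra_simps)
  qed
  then show ?thesis
    unfolding entire_finite_order_iff using G(1-3) H(1-3)
    by (intro conjI holomorphic_intros exI[of _ "max A B"] exI[of _ "C + D"]) auto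
qed

lemma entire_finite_order_cmult:
  assumes "entire_finite_order G"
  shows "entire_finite_order (\<lambda>s. c * G s)"
proof -
  obtain A C where G: "G holomorphic_on UNIV" "A \<ge> 1" "C \<ge> 0"
      "\<And>s. norm s \<ge> 2 \<Longrightarrow> norm (G s) \<le> C * exp (norm s powr A)"
    using assms(1) unfolding entire_finite_order_iff by blast
  then show ?thesis
    unfolding entire_finite_order_iff
    by (intro conjI holomorphic_intros exI[of _ A] exI[of _ "norm c * C"])
      (auto simp: norm_mult mult.assoc intro!: mult_left_mono)
qed

text \<open>The linear factor is absorbed in two stages:
  \<open>|s - 1| <= 2 |s| <= 2 exp (|s| powr A)\<close>, and
  \<open>2 |s| powr A <= |s| powr (A + 1)\<close> since \<open>|s| >= 2\<close>.\<close>

lemma entire_finite_order_shift_mult: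
  assumes "entire_finite_order G"
  shows "entire_finite_order (\<lambda>s. (s - 1) * G s)"
proof -
  obtain A C where G: "G holomorphic_on UNIV" "A \<ge> 1" "C \<ge> 0"
      "\<And>s. norm s \<ge> 2 \<Longrightarrow> norm (G s) \<le> C * exp (norm s powr A)"
    using assms(1) unfolding entire_finite_order_iff by blast
  have "norm ((s - 1) * G s) \<le> (2 * C) * exp (norm s powr (A + 1))" if s: "norm s \<ge> 2" for s
  proof -
    have "norm (s - 1) \<le> 2 * norm s"
      using norm_triangle_ineq4[of s 1] s by simp
    also have "norm s \<le> norm s powr A"
      using powr_mono[of 1 A "norm s"] s G(2) by (simp add: powr_one)
    also have "norm s powr A \<le> exp (norm s powr A)"
      using exp_ge_add_one_self[of "norm s powr A"] by linarith
    finally have "norm (s - 1) \<le> 2 * exp (norm s powr A)"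
      by simp
    then have "norm ((s - 1) * G s) \<le> (2 * exp (norm s powr A)) * (C * exp (norm s powr A))"
      unfolding norm_mult using G(3,4) s by (intro mult_mono) auto
    also have "\<dots> = 2 * C * exp (2 * norm s powr A)"
      by (simp only: mult_2 exp_add) simp
    also have "\<dots> \<le> 2 * C * exp (norm s powr (A + 1))"
    proof -
      have "2 * norm s powr A \<le> norm s powr (A + 1)"
        using s mult_right_mono[of 2 "norm s" "norm s powr A"] by (simp add: powr_add mult.commute)
      then show ?thesis
        using G(3) by (simp add: mult_left_mono)
    qed
    finally show ?thesis .
  qed
  then show ?thesis
    unfolding entire_finite_order_iff using G(1-3)
    by (intro conjI holomorphic_intros exI[of _ "A + 1"] exI[of _ "2 * C"]) auto
qed

lemma entire_finite_order_shift_power_mult: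
  assumes "entire_finite_order G"
  shows "entire_finite_order (\<lambda>s. (s - 1) ^ k * G s)"
proof (induction k)
  case (Suc k)
  from entire_finite_order_shift_mult[OF this] show ?case by (simp add: mult.assoc)
qed (use assms in simp)

lemma entire_finite_order_sum:
  assumes "finite S" "\<And>j. j \<in> S \<Longrightarrow> entire_finite_order (G j)"
  shows "entire_finite_order (\<lambda>s. \<Sum>j\<in>S. G j s)"
  using assms by (induction S) (auto intro: entire_finite_order_0 entire_finite_order_add)

text \<open>The exponents \<open>m j\<close> may differ, so each \<open>G j\<close> is multiplied by
  the power of \<open>s - 1\<close> that is missing to the common exponent \<open>M\<close>.\<close>

lemma cond_IV_lincomb:
  fixes F :: "'n::finite \<Rightarrow> complex \<Rightarrow> complex" and c :: "complex ^ 'n"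
  assumes "\<And>j. cond_IV (F j)"
  shows "cond_IV (lincomb c F)"
proof -
  obtain m G where G: "\<And>j. entire_finite_order (G j)"
      "\<And>j s. s \<noteq> 1 \<Longrightarrow> G j s = (s - 1) ^ m j * F j s"
    using assms unfolding cond_IV_def by metis
  define M where "M = (\<Sum>j\<in>UNIV. m j)"
  have M: "m j \<le> M" for j
    unfolding M_def by (rule member_le_sum) auto
  define H where "H s = (\<Sum>j\<in>UNIV. c $ j * ((s - 1) ^ (M - m j) * G j s))" for s
  have "entire_finite_order H"
    unfolding H_def
    by (intro entire_finite_order_sum entire_finite_order_cmult entire_finite_order_shift_power_mult G) auto
  moreover have "H s = (s - 1) ^ M * lincomb c F s" if "s \<noteq> 1" for s
  proof -
    have "(s - 1) ^ (M - m j) * G j s = (s - 1) ^ M * F j s" for j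
      using G(2)[OF that, of j] M[of j] by (simp flip: power_add mult.assoc)
    then show ?thesis
      by (simp add: H_def lincomb_def sum_distrib_left mult_ac)
  qed
  ultimately show ?thesis
    unfolding cond_IV_def by blast
qed

text \<open>\<open>completed\<close> is linear in the function, but the functional equation
  conjugates coefficients. The condition on \<open>c\<close> compensates for this, so that every
  summand has the same root number \<open>\<omega>'\<close>.\<close>

lemma cond_V_lincomb:
  fixes F :: "'n::finite \<Rightarrow> complex \<Rightarrow> complex" and c :: "complex ^ 'n"
  assumes F: "\<And>j. cond_V r Q lam mu (\<omega> j) (F j)" and "norm \<omega>' = 1"
    and c: "\<And>j. c $ j * \<omega> j = \<omega>' * cnj (c $ j)"
  shows "cond_V r Q lam mu \<omega>' (lincomb c F)"
proof -
  have lin: "completed r Q lam mu (lincomb c F) s = (\<Sum>j\<in>UNIV. c $ j * completed r Q lam mu (F j) s)" for s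
    unfolding completed_def lincomb_def sum_distrib_left by (intro sum.cong) (auto simp: mult_ac)
  show ?thesis
    unfolding cond_V_def
  proof (intro conjI allI impI)
    fix s assume s: "completed_regular_at r lam mu s \<and> completed_regular_at r lam mu (1 - cnj s)"
    have "c $ j * completed r Q lam mu (F j) s = \<omega>' * cnj (c $ j * completed r Q lam mu (F j) (1 - cnj s))" for j
    proof -
      have "completed r Q lam mu (F j) s = \<omega> j * cnj (completed r Q lam mu (F j) (1 - cnj s))"
        using F[of j] s unfolding cond_V_def by blast
      then show ?thesis
        using c[of j] by (simp flip: mult.assoc)
    qed
    then show "completed r Q lam mu (lincomb c F) s = \<omega>' * cnj (completed r Q lam mu (lincomb c F) (1 - cnj s))"
      by (simp add: lin sum_distrib_left cnj_sum)
  qed fact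
qed

section \<open>Twists of Euler products\<close>

text \<open>The logarithm of the Euler product in which \<open>p powr (- s)\<close> is replaced by
  \<open>z p * p powr (- s)\<close>. For unimodular \<open>z\<close> the exponential is a limit of
  vertical shifts of the original product.\<close>

definition twisted_log :: "(nat \<Rightarrow> complex) \<Rightarrow> (nat \<Rightarrow> complex) \<Rightarrow> complex \<Rightarrow> complex" where
  "twisted_log b z s =
     (\<Sum>\<^sub>\<infinity>(p, k)\<in>{p. prime p} \<times> {1..}. b (p ^ k) * z p ^ k * of_nat p powr (- (of_nat k * s)))"

text \<open>The argument \<open>q\<close> stands for \<open>p powr (- s)\<close>; as a free variable
  it can be moved independently of \<open>s\<close>.\<close>

definition local_log :: "(nat \<Rightarrow> complex) \<Rightarrow> nat \<Rightarrow> complex \<Rightarrow> complex" where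
  "local_log b p q = (\<Sum>\<^sub>\<infinity>k\<in>{1..}. b (p ^ k) * q ^ k)"

definition away_log :: "(nat \<Rightarrow> complex) \<Rightarrow> nat \<Rightarrow> complex \<Rightarrow> complex" where
  "away_log b p s =
     (\<Sum>\<^sub>\<infinity>(p', k)\<in>({p. prime p} - {p}) \<times> {1..}. b (p' ^ k) * of_nat p' powr (- (of_nat k * s)))"

text \<open>Condition (II) with its coefficients exposed, since the same \<open>b\<close> has to
  feed the twisted, local and away sums.\<close>

definition log_coeffs :: "(complex \<Rightarrow> complex) \<Rightarrow> (nat \<Rightarrow> complex) \<Rightarrow> bool" where
  "log_coeffs F b \<longleftrightarrow>
     (\<forall>s. Re s > 1 \<longrightarrow>
        exp (twisted_log b (\<lambda>_. 1) s) = F s \<and>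
        (\<lambda>(p, k). norm (b (p ^ k) * of_nat p powr (- (of_nat k * s)))) summable_on ({p. prime p} \<times> {1..})) \<and>
     (\<exists>\<theta> C :: real. \<theta> < 1 / 2 \<and>
        (\<forall>p k. prime p \<longrightarrow> k \<ge> 1 \<longrightarrow> norm (b (p ^ k)) \<le> C * real p powr (real k * \<theta>)))"

lemma cond_II_log_coeffs:
  assumes "cond_II F"
  obtains b where "log_coeffs F b"
proof -
  obtain l :: "complex \<Rightarrow> complex" and b :: "nat \<Rightarrow> complex" where
    "\<forall>s. Re s > 1 \<longrightarrow> exp (l s) = F s \<and>
           (\<lambda>(p, k). norm (b (p ^ k) * of_nat p powr (- (of_nat k * s))))
              summable_on ({p. prime p} \<times> {1..}) \<and>
           l s = (\<Sum>\<^sub>\<infinity>(p, k)\<in>{p. prime p} \<times> {1..}.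
                    b (p ^ k) * of_nat p powr (- (of_nat k * s)))"
    "\<exists>\<theta> C :: real. \<theta> < 1 / 2 \<and>
           (\<forall>p k. prime p \<longrightarrow> k \<ge> 1 \<longrightarrow> norm (b (p ^ k)) \<le> C * real p powr (real k * \<theta>))"
    using assms unfolding cond_II_def by blast
  then have "log_coeffs F b"
    unfolding log_coeffs_def twisted_log_def by auto
  then show thesis by (rule that)
qed

lemma log_coeffs_exp: "log_coeffs F b \<Longrightarrow> Re s > 1 \<Longrightarrow> exp (twisted_log b (\<lambda>_. 1) s) = F s"
  and log_coeffs_summable: "log_coeffs F b \<Longrightarrow> Re s > 1 \<Longrightarrow>
    (\<lambda>(p, k). norm (b (p ^ k) * of_nat p powr (- (of_nat k * s)))) summable_on ({p. prime p} \<times> {1..})"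
  unfolding log_coeffs_def by auto

text \<open>The bound on \<open>b (p ^ k)\<close> gives convergence for
  \<open>norm q < p powr (- \<theta>)\<close>. As \<open>\<theta> < 1/2\<close>, this disc contains
  the circle of radius \<open>p powr (- (1/2))\<close>, the image of the critical line under
  \<open>p powr (- s)\<close>.\<close>

lemma log_coeffs_local_log_holomorphic:
  assumes "log_coeffs F b"
  obtains \<theta> where "\<theta> < 1 / 2" "\<And>p. prime p \<Longrightarrow> local_log b p holomorphic_on ball 0 (real p powr (- \<theta>))"
proof -
  obtain \<theta> C :: real where \<theta>: "\<theta> < 1 / 2"
    and b: "\<And>p k. prime p \<Longrightarrow> k \<ge> 1 \<Longrightarrow> norm (b (p ^ k)) \<le> C * real p powr (real k * \<theta>)"
    using assms unfolding log_coeffs_def by blast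
  show thesis
  proof (rule that[OF \<theta>])
    fix p :: nat assume p: "prime p"
    then have p2: "p \<ge> 2" by (rule prime_ge_2_nat)
    \<comment> \<open>The sum in \<open>local_log\<close> starts at 1, so the constant coefficient
      is 0, not \<open>b 1\<close>.\<close>
    define a where "a k = (if k = 0 then 0 else b (p ^ k))" for k
    show "local_log b p holomorphic_on ball 0 (real p powr (- \<theta>))"
    proof (rule power_series_holomorphic[where a = a])
      fix q :: complex assume "q \<in> ball 0 (real p powr (- \<theta>))"
      then have q: "norm q * real p powr \<theta> < 1"
        using p2 by (simp add: powr_minus field_simps)
      have "0 \<le> C * real p powr \<theta>"
        using order_trans[OF norm_ge_zero b[OF p, of 1]] by simp
      moreover have "real p powr \<theta> > 0" using p2 by simp
      ultimately have "C \<ge> 0" by (simp add: zero_le_mult_iff)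
      have "norm (a k * q ^ k) \<le> C * (norm q * real p powr \<theta>) ^ k" for k
      proof (cases "k = 0")
        case False
        have "norm (a k * q ^ k) \<le> C * real p powr (real k * \<theta>) * norm q ^ k"
          using b[OF p, of k] False unfolding norm_mult norm_power a_def
          by (auto intro!: mult_right_mono)
        also have "real p powr (real k * \<theta>) = (real p powr \<theta>) ^ k"
          using p2 by (simp add: powr_powr[symmetric] mult.commute[of "real k"] powr_realpow)
        finally show ?thesis by (simp add: power_mult_distrib mult_ac)
      qed (simp add: a_def \<open>C \<ge> 0\<close>)
      then have sm: "summable (\<lambda>k. norm (a k * q ^ k))"
        by (intro summable_comparison_test'[OF summable_mult[OF summable_geometric]]) (use q in auto)
      have "(\<lambda>k. a k * q ^ k) sums (infsum (\<lambda>k. a k * q ^ k) UNIV)"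
        by (intro has_sum_imp_sums has_sum_infsum norm_summable_imp_summable_on sm)
      also have "infsum (\<lambda>k. a k * q ^ k) UNIV = local_log b p q"
        unfolding local_log_def by (rule infsum_cong_neutral) (auto simp: a_def)
      finally show "(\<lambda>n. a n * (q - 0) ^ n) sums local_log b p q" by simp
    qed
  qed
qed

lemma local_log_holomorphic:
  assumes "log_coeffs F b" "prime p"
  shows "local_log b p holomorphic_on ball 0 (real p powr (- (1 / 2)))"
proof -
  obtain \<theta> where \<theta>: "\<theta> < 1 / 2" "local_log b p holomorphic_on ball 0 (real p powr (- \<theta>))"
    using log_coeffs_local_log_holomorphic[OF assms(1)] assms(2) by blast
  have "real p powr (- (1 / 2)) \<le> real p powr (- \<theta>)"
    using \<theta>(1) prime_ge_2_nat[OF assms(2)] by (intro powr_mono) auto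
  then show ?thesis
    using \<theta>(2) by (meson holomorphic_on_subset subset_ball)
qed

lemma local_log_0: "local_log b p 0 = 0"
  unfolding local_log_def by (rule infsum_0) auto

lemma away_log_tendsto_0:
  assumes "log_coeffs F b"
  shows "(\<lambda>n. away_log b p (of_nat (n + 2))) \<longlonglongrightarrow> 0"
  unfolding away_log_def
  by (rule prime_power_series_tendsto_0)
    (auto intro!: summable_on_subset_banach[OF log_coeffs_summable[OF assms, of 2]])

lemma twisted_log_tendsto_0:
  assumes "log_coeffs F b"
  shows "(\<lambda>n. twisted_log b (\<lambda>_. 1) (of_nat (n + 2))) \<longlonglongrightarrow> 0"
  unfolding twisted_log_def
  using prime_power_series_tendsto_0[of "{p. prime p}" b] log_coeffs_summable[OF assms, of 2] by simp

lemma log_coeffs_tendsto_1: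
  assumes "log_coeffs F b"
  shows "(\<lambda>n. F (of_nat (n + 2))) \<longlonglongrightarrow> 1"
proof -
  have "(\<lambda>n. exp (twisted_log b (\<lambda>_. 1) (of_nat (n + 2)))) \<longlonglongrightarrow> exp 0"
    by (intro tendsto_exp twisted_log_tendsto_0[OF assms])
  moreover have "exp (twisted_log b (\<lambda>_. 1) (of_nat (n + 2))) = F (of_nat (n + 2))" for n
    by (rule log_coeffs_exp[OF assms]) simp
  ultimately show ?thesis by simp
qed

lemma powr_of_nat_mult:
  fixes x w :: complex
  assumes "x \<noteq> 0"
  shows "x powr (of_nat k * w) = (x powr w) ^ k"
  using assms by (simp add: powr_def mult.assoc exp_of_nat_mult)

text \<open>Shifting by \<open>\<i> * t\<close> multiplies the term at \<open>(p, k)\<close> by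
  \<open>(p powr (- \<i> * t)) ^ k\<close>, of modulus 1, so the unshifted series dominates.\<close>

lemma twisted_log_vertical_shift:
  assumes b: "log_coeffs F b" and s: "Re s > 1"
    and t: "\<And>p. prime p \<Longrightarrow> (\<lambda>n. of_nat p powr (- (\<i> * of_real (t n)))) \<longlonglongrightarrow> z p"
  shows "(\<lambda>n. twisted_log b (\<lambda>_. 1) (s + \<i> * of_real (t n))) \<longlonglongrightarrow> twisted_log b z s"
  unfolding twisted_log_def
proof (rule tendsto_infsum_dominated[OF _ _ log_coeffs_summable[OF b s]], goal_cases)
  case (1 x)
  then obtain p k where x: "x = (p, k)" "prime p" "k \<ge> 1" by auto
  have "of_nat p powr (- (of_nat k * (s + \<i> * of_real (t n)))) =
      (of_nat p powr (- (\<i> * of_real (t n)))) ^ k * of_nat p powr (- (of_nat k * s))" for n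
  proof -
    have eq: "- (of_nat k * (s + \<i> * of_real (t n))) = of_nat k * (- (\<i> * of_real (t n))) + (- (of_nat k * s))"
      by (simp add: algebra_simps)
    show ?thesis
      unfolding eq powr_add using prime_gt_0_nat[OF x(2)] by (subst powr_of_nat_mult) auto
  qed
  then show ?case
    by (auto simp: x mult.assoc intro!: tendsto_intros t)
next
  case (2 n x)
  then obtain p k where x: "x = (p, k)" "prime p" "k \<ge> 1" by auto
  then show ?case
    using prime_gt_0_nat[OF x(2)] by (simp add: norm_mult norm_powr_real_powr)
qed

lemma twisted_log_split:
  assumes b: "log_coeffs F b" and s: "Re s > 1" and p: "prime p" and \<zeta>: "norm \<zeta> = 1"
  shows "twisted_log b (\<lambda>p'. if p' = p then \<zeta> else 1) s =
     local_log b p (\<zeta> * of_nat p powr (- s)) + away_log b p s"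
proof -
  define f where "f = (\<lambda>(p', k). b (p' ^ k) * (if p' = p then \<zeta> else 1) ^ k * of_nat p' powr (- (of_nat k * s)))"
  have "(\<lambda>x. norm (f x)) summable_on ({p. prime p} \<times> {1..})"
    by (rule iffD1[OF summable_on_cong log_coeffs_summable[OF b s]])
      (auto simp: f_def norm_mult norm_power \<zeta>)
  then have f: "f summable_on ({p. prime p} \<times> {1..})"
    by (rule abs_summable_summable)
  have "{p. prime p} \<times> {1..} = {p} \<times> {1..} \<union> ({p. prime p} - {p}) \<times> {1::nat..}"
    using p by auto
  then have "infsum f ({p. prime p} \<times> {1..}) =
      infsum f ({p} \<times> {1..} \<union> ({p. prime p} - {p}) \<times> {1..})"
    by simp
  also have "\<dots> = infsum f ({p} \<times> {1..}) + infsum f (({p. prime p} - {p}) \<times> {1..})"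
    by (rule infsum_Un_disjoint) (use p in \<open>auto intro!: summable_on_subset_banach[OF f]\<close>)
  also have "infsum f ({p} \<times> {1..}) = infsum (f \<circ> Pair p) {1..}"
    by (subst infsum_reindex[symmetric]) (auto simp: inj_on_def intro!: arg_cong[of _ _ "infsum f"])
  also have "\<dots> = local_log b p (\<zeta> * of_nat p powr (- s))"
    unfolding local_log_def
  proof (rule infsum_cong)
    fix k :: nat assume "k \<in> {1..}"
    have "of_nat p powr (- (of_nat k * s)) = (of_nat p powr (- s)) ^ k"
      using powr_of_nat_mult[of "of_nat p" k "- s"] prime_gt_0_nat[OF p] by simp
    then show "(f \<circ> Pair p) k = b (p ^ k) * (\<zeta> * of_nat p powr (- s)) ^ k"
      by (simp add: f_def power_mult_distrib)
  qed
  also have "infsum f (({p. prime p} - {p}) \<times> {1..}) = away_log b p s"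
    unfolding away_log_def
  proof (rule infsum_cong)
    fix x :: "nat \<times> nat" assume "x \<in> ({p. prime p} - {p}) \<times> {1..}"
    then have "fst x \<noteq> p" by auto
    then show "f x = (case x of (p', k) \<Rightarrow> b (p' ^ k) * of_nat p' powr (- (of_nat k * s)))"
      by (simp add: f_def case_prod_unfold)
  qed
  finally show ?thesis unfolding twisted_log_def f_def .
qed

lemma twisted_log_eq_sum_local_log:
  assumes b: "log_coeffs F b" and s: "Re s > 1"
  shows "twisted_log b (\<lambda>_. 1) s = (\<Sum>\<^sub>\<infinity>p\<in>{p. prime p}. local_log b p (of_nat p powr (- s)))"
proof -
  define f where "f = (\<lambda>(p, k). b (p ^ k) * of_nat p powr (- (of_nat k * s)))"
  have "(\<lambda>x. norm (f x)) summable_on ({p. prime p} \<times> {1..})"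
    by (rule iffD1[OF summable_on_cong log_coeffs_summable[OF b s]]) (auto simp: f_def)
  then have f: "f summable_on ({p. prime p} \<times> {1..})"
    by (rule abs_summable_summable)
  have "infsum f ({p. prime p} \<times> {1..}) = (\<Sum>\<^sub>\<infinity>p\<in>{p. prime p}. \<Sum>\<^sub>\<infinity>k\<in>{1..}. f (p, k))"
    by (rule infsum_Sigma_banach[OF f, symmetric])
  also have "\<dots> = (\<Sum>\<^sub>\<infinity>p\<in>{p. prime p}. local_log b p (of_nat p powr (- s)))"
    unfolding local_log_def
  proof (intro infsum_cong)
    fix p k :: nat assume p: "p \<in> {p. prime p}"
    have "of_nat p powr (- (of_nat k * s)) = (of_nat p powr (- s)) ^ k"
      using powr_of_nat_mult[of "of_nat p" k "- s"] p prime_gt_0_nat by auto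
    then show "f (p, k) = b (p ^ k) * (of_nat p powr (- s)) ^ k"
      by (simp add: f_def)
  qed
  finally show ?thesis by (simp add: twisted_log_def f_def)
qed

text \<open>On the circle of radius \<open>p powr (- Re s)\<close> one has
  \<open>q = \<zeta> * p powr (- s)\<close> with \<open>\<zeta>\<close> unimodular. Kronecker shifts
  that tend to \<open>\<zeta>\<close> at \<open>p\<close> and to 1 at all other primes carry the
  relation to the limit; the identity theorem in \<open>q\<close> then extends it from the circle to
  the disc.\<close>

lemma linear_relation_local_away:
  assumes b1: "log_coeffs F1 b1" and b2: "log_coeffs F2 b2" and b3: "log_coeffs F3 b3"
    and rel: "\<And>s. Re s > 1 \<Longrightarrow> F3 s = \<alpha> * F1 s + \<beta> * F2 s"
    and p: "prime p" and s: "Re s > 1" and q: "q \<in> ball 0 (real p powr (- (1 / 2)))"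
  shows "exp (local_log b3 p q + away_log b3 p s) =
     \<alpha> * exp (local_log b1 p q + away_log b1 p s) + \<beta> * exp (local_log b2 p q + away_log b2 p s)"
proof -
  have p2: "p \<ge> 2" using prime_ge_2_nat[OF p] .
  define G where "G q = exp (local_log b3 p q + away_log b3 p s) -
     (\<alpha> * exp (local_log b1 p q + away_log b1 p s) + \<beta> * exp (local_log b2 p q + away_log b2 p s))" for q
  define \<rho> where "\<rho> = real p powr (- Re s)"
  have \<rho>: "\<rho> > 0" "\<rho> < real p powr (- (1 / 2))"
    unfolding \<rho>_def using p2 s by (auto intro!: powr_less_mono)
  have "G q = 0"
  proof (rule analytic_continuation[of G "ball 0 (real p powr (- (1 / 2)))" "sphere 0 \<rho>" "of_real \<rho>"])
    show "G holomorphic_on ball 0 (real p powr (- (1 / 2)))"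
      unfolding G_def by (intro holomorphic_intros local_log_holomorphic[OF b1 p] local_log_holomorphic[OF b2 p]
        local_log_holomorphic[OF b3 p])
    show "complex_of_real \<rho> islimpt sphere 0 \<rho>"
    proof (rule connected_imp_perfect)
      show "connected (sphere (0::complex) \<rho>)"
        by (rule connected_sphere) simp
      show "sphere 0 \<rho> \<noteq> {x :: complex}" for x
      proof
        assume "sphere 0 \<rho> = {x :: complex}"
        moreover have "complex_of_real \<rho> \<in> sphere 0 \<rho>" "- complex_of_real \<rho> \<in> sphere 0 \<rho>"
          using \<rho> by auto
        ultimately have "complex_of_real \<rho> = - complex_of_real \<rho>" by auto
        then show False using \<rho> by (simp add: complex_eq_iff)
      qed
    qed (use \<rho> in auto)
    show "G w = 0" if "w \<in> sphere 0 \<rho>" for w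
    proof -
      define \<zeta> where "\<zeta> = w / of_nat p powr (- s)"
      have np: "norm (of_nat p powr (- s)) = \<rho>"
        unfolding \<rho>_def using p2 by (simp add: norm_powr_real_powr)
      have \<zeta>: "norm \<zeta> = 1"
        using that np \<rho> by (simp add: \<zeta>_def norm_divide)
      have w: "\<zeta> * of_nat p powr (- s) = w"
        using p2 by (simp add: \<zeta>_def)
      define z where "z = (\<lambda>p'. if p' = p then \<zeta> else 1)"
      have "norm (z p') = 1" for p' by (simp add: z_def \<zeta>)
      then obtain t where t: "\<And>p'. prime p' \<Longrightarrow> (\<lambda>n. of_nat p' powr (- (\<i> * of_real (t n)))) \<longlonglongrightarrow> z p'"
        using Kronecker_primes[of z] by blast
      have lim: "(\<lambda>n. F (s + \<i> * of_real (t n))) \<longlonglongrightarrow> exp (local_log b p w + away_log b p s)"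
        if b: "log_coeffs F b" for F b
      proof -
        have "(\<lambda>n. exp (twisted_log b (\<lambda>_. 1) (s + \<i> * of_real (t n)))) \<longlonglongrightarrow> exp (twisted_log b z s)"
          by (intro tendsto_exp twisted_log_vertical_shift[OF b s t])
        also have "twisted_log b z s = local_log b p w + away_log b p s"
          unfolding z_def w[symmetric] by (rule twisted_log_split[OF b s p \<zeta>])
        also have "(\<lambda>n. exp (twisted_log b (\<lambda>_. 1) (s + \<i> * of_real (t n)))) = (\<lambda>n. F (s + \<i> * of_real (t n)))"
          using s by (intro ext log_coeffs_exp[OF b]) simp
        finally show ?thesis .
      qed
      have "(\<lambda>n. \<alpha> * F1 (s + \<i> * of_real (t n)) + \<beta> * F2 (s + \<i> * of_real (t n))) \<longlonglongrightarrow>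
          \<alpha> * exp (local_log b1 p w + away_log b1 p s) + \<beta> * exp (local_log b2 p w + away_log b2 p s)"
        by (intro tendsto_intros lim b1 b2)
      also have "(\<lambda>n. \<alpha> * F1 (s + \<i> * of_real (t n)) + \<beta> * F2 (s + \<i> * of_real (t n))) =
          (\<lambda>n. F3 (s + \<i> * of_real (t n)))"
        using s by (intro ext rel[symmetric]) simp
      finally show "G w = 0"
        using LIMSEQ_unique[OF _ lim[OF b3]] by (simp add: G_def)
    qed
  qed (use \<rho> q in auto)
  then show ?thesis by (simp add: G_def)
qed

text \<open>
  Setting \<open>q = 0\<close>, respectively letting \<open>s \<rightarrow> \<infinity>\<close>, shows that the relation holds separately for the factors
  \<open>x\<^sub>i\<close> away from \<open>p\<close> and for the local factors \<open>a\<^sub>i\<close>, and that \<open>\<alpha> + \<beta> = 1\<close>. Multiplying out leaves \<open>\<alpha> \<beta> (a\<^sub>1 - a\<^sub>2) (x\<^sub>1 - x\<^sub>2) = 0\<close>.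
\<close>

lemma linear_relation_dichotomy:
  assumes b1: "log_coeffs F1 b1" and b2: "log_coeffs F2 b2" and b3: "log_coeffs F3 b3"
    and rel: "\<And>s. Re s > 1 \<Longrightarrow> F3 s = \<alpha> * F1 s + \<beta> * F2 s"
    and nz: "\<alpha> \<noteq> 0" "\<beta> \<noteq> 0" and p: "prime p"
  shows "(\<forall>q\<in>ball 0 (real p powr (- (1 / 2))). exp (local_log b1 p q) = exp (local_log b2 p q)) \<or>
     (\<forall>s. Re s > 1 \<longrightarrow> exp (away_log b1 p s) = exp (away_log b2 p s))"
proof -
  have R: "exp (local_log b3 p q + away_log b3 p s) =
     \<alpha> * exp (local_log b1 p q + away_log b1 p s) + \<beta> * exp (local_log b2 p q + away_log b2 p s)"
    if "Re s > 1" "q \<in> ball 0 (real p powr (- (1 / 2)))" for s q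
    using linear_relation_local_away[OF b1 b2 b3 _ p that] rel by blast
  have away: "exp (away_log b3 p s) = \<alpha> * exp (away_log b1 p s) + \<beta> * exp (away_log b2 p s)"
    if "Re s > 1" for s
    using R[OF that, of 0] prime_gt_0_nat[OF p] by (simp add: local_log_0)
  have lim: "(\<lambda>n. exp (x + away_log b p (of_nat (n + 2)))) \<longlonglongrightarrow> exp x" if "log_coeffs F b" for x b F
    using tendsto_exp[OF tendsto_add[OF tendsto_const away_log_tendsto_0[OF that]], of x] by simp
  have loc: "exp (local_log b3 p q) = \<alpha> * exp (local_log b1 p q) + \<beta> * exp (local_log b2 p q)"
    if "q \<in> ball 0 (real p powr (- (1 / 2)))" for q
  proof -
    have "(\<lambda>n. \<alpha> * exp (local_log b1 p q + away_log b1 p (of_nat (n + 2))) +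
        \<beta> * exp (local_log b2 p q + away_log b2 p (of_nat (n + 2)))) \<longlonglongrightarrow>
        \<alpha> * exp (local_log b1 p q) + \<beta> * exp (local_log b2 p q)"
      by (intro tendsto_intros lim[OF b1] lim[OF b2])
    also have "(\<lambda>n. \<alpha> * exp (local_log b1 p q + away_log b1 p (of_nat (n + 2))) +
        \<beta> * exp (local_log b2 p q + away_log b2 p (of_nat (n + 2)))) =
        (\<lambda>n. exp (local_log b3 p q + away_log b3 p (of_nat (n + 2))))"
      by (intro ext R[symmetric] that) auto
    finally show ?thesis
      using LIMSEQ_unique[OF lim[OF b3]] by blast
  qed
  have ab: "\<beta> = 1 - \<alpha>"
    using loc[of 0] prime_gt_0_nat[OF p] by (simp add: local_log_0 algebra_simps)
  have "exp (local_log b1 p q) = exp (local_log b2 p q) \<or> exp (away_log b1 p s) = exp (away_log b2 p s)"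
    if q: "q \<in> ball 0 (real p powr (- (1 / 2)))" and s: "Re s > 1" for q s
  proof -
    have eq: "\<alpha> * \<beta> * ((a1 - a2) * (x1 - x2)) = 0"
      if "(\<alpha> * a1 + \<beta> * a2) * (\<alpha> * x1 + \<beta> * x2) = \<alpha> * (a1 * x1) + \<beta> * (a2 * x2)" for a1 a2 x1 x2 :: complex
    proof -
      have "\<alpha> * \<beta> * ((a1 - a2) * (x1 - x2)) =
          (\<alpha> * (a1 * x1) + \<beta> * (a2 * x2)) - (\<alpha> * a1 + \<beta> * a2) * (\<alpha> * x1 + \<beta> * x2)"
        unfolding ab by (simp add: algebra_simps)
      then show ?thesis using that by simp
    qed
    have "\<alpha> * \<beta> * ((exp (local_log b1 p q) - exp (local_log b2 p q)) *
        (exp (away_log b1 p s) - exp (away_log b2 p s))) = 0"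
      by (rule eq) (use R[OF s q] loc[OF q] away[OF s] in \<open>simp add: exp_add\<close>)
    with nz show ?thesis by simp
  qed
  \<comment> \<open>Since \<open>q\<close> and \<open>s\<close> vary independently, one
    \<open>q\<close> with different local factors forces equality of the away factors for every
    \<open>s\<close>.\<close>
  then show ?thesis by blast
qed

section \<open>Absence of linear relations\<close>

lemma cond_IV_holomorphic:
  assumes "cond_IV F"
  shows "F holomorphic_on - {1}"
proof -
  obtain m :: nat and G where G: "entire_finite_order G" "\<And>s. s \<noteq> 1 \<Longrightarrow> G s = (s - 1) ^ m * F s"
    using assms unfolding cond_IV_def by blast
  have "(\<lambda>s. G s / (s - 1) ^ m) holomorphic_on - {1}"
    using G(1) unfolding entire_finite_order_def
    by (intro holomorphic_intros) (auto intro: holomorphic_on_subset)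
  then show ?thesis
    by (rule holomorphic_transform) (simp add: G(2))
qed

text \<open>Both \<open>exp (\<i> * B)\<close> and \<open>exp (- \<i> * B)\<close> have modulus 1 on
  the circle, so the maximum modulus principle bounds them by 1 inside. Hence \<open>B\<close> is
  real throughout the disc, and a real-valued holomorphic function is constant.\<close>

lemma holomorphic_real_on_circle_imp_constant:
  fixes B :: "complex \<Rightarrow> complex"
  assumes hol: "B holomorphic_on ball 0 R" and \<rho>: "0 < \<rho>" "\<rho> < R"
    and real: "\<And>q. norm q = \<rho> \<Longrightarrow> Im (B q) = 0" and q: "norm q < \<rho>"
  shows "B q = B 0"
proof -
  have sub: "cball 0 \<rho> \<subseteq> ball 0 R" using \<rho> by auto
  have bound: "norm (exp (c * B z)) \<le> 1" if "norm z < \<rho>" "c = \<i> \<or> c = - \<i>" for c z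
  proof (rule maximum_modulus_frontier[of "\<lambda>x. exp (c * B x)" "ball 0 \<rho>"])
    have "(\<lambda>x. exp (c * B x)) holomorphic_on cball 0 \<rho>"
      by (intro holomorphic_intros holomorphic_on_subset[OF hol sub])
    then show "(\<lambda>x. exp (c * B x)) holomorphic_on interior (ball 0 \<rho>)"
        "continuous_on (closure (ball 0 \<rho>)) (\<lambda>x. exp (c * B x))"
      using \<rho> by (auto intro: holomorphic_on_subset holomorphic_on_imp_continuous_on)
    show "norm (exp (c * B x)) \<le> 1" if "x \<in> frontier (ball 0 \<rho>)" for x
      using real[of x] that \<open>c = \<i> \<or> c = - \<i>\<close> \<rho> by auto
  qed (use that in auto)
  have ImB: "Im (B z) = 0" if "z \<in> ball 0 \<rho>" for z
    using bound[of z \<i>] bound[of z "- \<i>"] that by simp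
  \<comment> \<open>The Cayley transform of a real-valued function has constant modulus 1.\<close>
  define C where "C z = (B z - \<i>) / (B z + \<i>)" for z
  have nz: "B z + \<i> \<noteq> 0" if "z \<in> ball 0 \<rho>" for z
    using ImB[OF that] by (auto simp: complex_eq_iff)
  have normC: "norm (C z) = 1" if "z \<in> ball 0 \<rho>" for z
  proof -
    have "norm (B z - \<i>) = norm (B z + \<i>)"
      using ImB[OF that] by (simp add: cmod_def)
    then show ?thesis
      using nz[OF that] by (simp add: C_def norm_divide)
  qed
  have "C constant_on ball 0 \<rho>"
  proof (rule maximum_modulus_principle[of C "ball 0 \<rho>" "ball 0 \<rho>" 0])
    show "C holomorphic_on ball 0 \<rho>"
      unfolding C_def
      by (intro holomorphic_intros holomorphic_on_subset[OF hol]) (use sub nz in auto)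
  qed (use \<rho> normC in auto)
  then have "C q = C 0"
    using q \<rho> unfolding constant_on_def by auto
  then have "(B q - \<i>) * (B 0 + \<i>) = (B 0 - \<i>) * (B q + \<i>)"
    using nz[of q] nz[of 0] q \<rho> by (simp add: C_def frac_eq_eq)
  then have "2 * \<i> * (B q - B 0) = 0"
    by (simp add: algebra_simps)
  then show ?thesis by simp
qed

text \<open>On the critical line \<open>s\<close> is fixed by the reflection, and the Gamma
  arguments have positive real part, so no poles occur. The factor \<open>\<kappa>\<close> depends
  on \<open>s\<close> and the parameters alone and is shared by all \<open>F\<close>.\<close>

lemma critical_line_functional_equation:
  assumes "Q > 0" and lam: "\<And>j. j \<in> {1..r} \<Longrightarrow> lam j > 0"
    and mu: "\<And>j. j \<in> {1..r} \<Longrightarrow> Re (mu j) \<ge> 0" and s: "Re s = 1 / 2"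
  obtains \<kappa> where "\<kappa> \<noteq> 0" "\<And>\<omega> F. cond_V r Q lam mu \<omega> F \<Longrightarrow> \<kappa> * F s = \<omega> * cnj (\<kappa> * F s)"
proof -
  have ni: "of_real (lam j) * s + mu j \<notin> \<int>\<^sub>\<le>\<^sub>0" if "j \<in> {1..r}" for j
  proof
    assume "of_real (lam j) * s + mu j \<in> \<int>\<^sub>\<le>\<^sub>0"
    then obtain n where n: "of_real (lam j) * s + mu j = of_int n" "n \<le> 0"
      by (auto elim!: nonpos_Ints_cases)
    have "Re (of_real (lam j) * s + mu j) \<le> 0"
      unfolding n(1) using n(2) by simp
    then show False
      using lam[OF that] mu[OF that] s by simp
  qed
  have refl: "1 - cnj s = s"
    using s by (simp add: complex_eq_iff)
  have reg: "completed_regular_at r lam mu s"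
    unfolding completed_regular_at_def using ni s by auto
  define \<kappa> where "\<kappa> = of_real Q powr s * (\<Prod>j=1..r. Gamma (of_real (lam j) * s + mu j))"
  have "\<kappa> \<noteq> 0"
    unfolding \<kappa>_def using \<open>Q > 0\<close> ni by (auto simp: Gamma_eq_zero_iff)
  moreover have "\<kappa> * F s = \<omega> * cnj (\<kappa> * F s)" if "cond_V r Q lam mu \<omega> F" for \<omega> F
  proof -
    have "completed_regular_at r lam mu s \<and> completed_regular_at r lam mu (1 - cnj s) \<longrightarrow>
        completed r Q lam mu F s = \<omega> * cnj (completed r Q lam mu F (1 - cnj s))"
      using that unfolding cond_V_def by blast
    with reg have "completed r Q lam mu F s = \<omega> * cnj (completed r Q lam mu F s)"
      unfolding refl by blast
    then show ?thesis
      unfolding completed_def \<kappa>_def .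
  qed
  ultimately show thesis by (rule that)
qed

lemma log_coeffs_local_away:
  assumes "log_coeffs F b" "prime p" "Re s > 1"
  shows "F s = exp (local_log b p (of_nat p powr (- s))) * exp (away_log b p s)"
  using twisted_log_split[OF assms(1,3,2), of 1] log_coeffs_exp[OF assms(1,3)]
  by (simp add: exp_add)

text \<open>Here \<open>F\<close> is \<open>A (p powr (- s)) * G\<close>, with \<open>A\<close> the
  quotient of the local factors. Continuation reaches the critical line because
  \<open>\<theta> < 1/2\<close>; there the shared factor \<open>\<kappa>\<close> turns the two
  functional equations into \<open>A = \<tau> * cnj A\<close> on a circle, which makes
  \<open>A\<close> constant.\<close>

lemma eq_if_differing_in_one_local_factor:
  assumes param: "Q > 0" "\<And>j. j \<in> {1..r} \<Longrightarrow> lam j > 0" "\<And>j. j \<in> {1..r} \<Longrightarrow> Re (mu j) \<ge> 0"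
    and F: "cond_IV F" "cond_V r Q lam mu \<omega>1 F" "log_coeffs F b1"
    and G: "cond_IV G" "cond_V r Q lam mu \<omega>2 G" "log_coeffs G b2"
    and p: "prime p" and away: "\<And>s. Re s > 1 \<Longrightarrow> exp (away_log b1 p s) = exp (away_log b2 p s)"
    and s: "Re s > 1"
  shows "F s = G s"
proof -
  have p2: "p \<ge> 2" using prime_ge_2_nat[OF p] .
  obtain \<theta>1 where \<theta>1: "\<theta>1 < 1 / 2" "local_log b1 p holomorphic_on ball 0 (real p powr (- \<theta>1))"
    using log_coeffs_local_log_holomorphic[OF F(3)] p by blast
  obtain \<theta>2 where \<theta>2: "\<theta>2 < 1 / 2" "local_log b2 p holomorphic_on ball 0 (real p powr (- \<theta>2))"
    using log_coeffs_local_log_holomorphic[OF G(3)] p by blast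
  define \<theta> where "\<theta> = max \<theta>1 \<theta>2"
  have \<theta>: "\<theta> < 1 / 2" using \<theta>1 \<theta>2 by (simp add: \<theta>_def)
  define R where "R = real p powr (- \<theta>)"
  have R: "ball 0 R \<subseteq> ball 0 (real p powr (- \<theta>1))" "ball 0 R \<subseteq> ball 0 (real p powr (- \<theta>2))"
    unfolding R_def \<theta>_def using p2 by (auto intro!: subset_ball powr_mono)
  define A where "A q = exp (local_log b1 p q - local_log b2 p q)" for q
  have A0: "A 0 = 1" by (simp add: A_def local_log_0)
  have holA: "A holomorphic_on ball 0 R"
    unfolding A_def
    by (intro holomorphic_intros holomorphic_on_subset[OF \<theta>1(2) R(1)] holomorphic_on_subset[OF \<theta>2(2) R(2)])
  have np: "norm (of_nat p powr (- z)) = real p powr (- Re z)" for z :: complex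
    using p2 by (simp add: norm_powr_real_powr)
  \<comment> \<open>The half-plane that \<open>p powr (- z)\<close> maps into the disc where
    \<open>A\<close> is holomorphic, without the point 1, where \<open>F\<close> and
    \<open>G\<close> may be singular.\<close>
  define S where "S = {z. Re z > \<theta>} - {1}"
  have inR: "of_nat p powr (- z) \<in> ball 0 R" if "Re z > \<theta>" for z
    using that p2 unfolding R_def mem_ball_0 np by (intro powr_less_mono) auto
  have holAS: "(\<lambda>z. A (of_nat p powr (- z))) holomorphic_on S"
    by (rule holomorphic_on_compose_gen[of "\<lambda>z. of_nat p powr (- z)" S A "ball 0 R", unfolded comp_def])
      (use inR p2 in \<open>auto simp: S_def intro!: holomorphic_intros holA\<close>)
  have FG1: "F z = A (of_nat p powr (- z)) * G z" if "Re z > 1" for z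
    unfolding log_coeffs_local_away[OF F(3) p that] log_coeffs_local_away[OF G(3) p that] away[OF that] A_def
    by (simp add: exp_diff)
  have openS: "open S"
    unfolding S_def by (intro open_delete open_halfspace_Re_gt)
  have connS: "connected S"
    unfolding S_def
    by (intro connected_open_delete open_halfspace_Re_gt convex_connected convex_halfspace_Re_gt) simp
  have FG: "F z = A (of_nat p powr (- z)) * G z" if "z \<in> S" for z
  proof (rule analytic_continuation_open[of "{z. Re z > 1}" S F "\<lambda>z. A (of_nat p powr (- z)) * G z"])
    show "{z. Re z > 1} \<subseteq> S" using \<theta> by (auto simp: S_def)
    show "F holomorphic_on S"
      by (rule holomorphic_on_subset[OF cond_IV_holomorphic[OF F(1)]]) (auto simp: S_def)
    show "(\<lambda>z. A (of_nat p powr (- z)) * G z) holomorphic_on S"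
      by (intro holomorphic_intros holAS holomorphic_on_subset[OF cond_IV_holomorphic[OF G(1)]]) (auto simp: S_def)
    show "{z. Re z > 1} \<noteq> {}" by (auto intro!: exI[of _ 2])
  qed (use openS connS FG1 that open_halfspace_Re_gt in auto)
  define \<tau> where "\<tau> = \<omega>1 / \<omega>2"
  have \<omega>: "norm \<omega>1 = 1" "norm \<omega>2 = 1"
    using F(2) G(2) by (auto simp: cond_V_def)
  have on_line: "A (of_nat p powr (- z)) = \<tau> * cnj (A (of_nat p powr (- z)))"
    if z: "Re z = 1 / 2" and "G z \<noteq> 0" for z
  proof -
    obtain \<kappa> where \<kappa>: "\<kappa> \<noteq> 0" "\<And>\<omega> F. cond_V r Q lam mu \<omega> F \<Longrightarrow> \<kappa> * F z = \<omega> * cnj (\<kappa> * F z)"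
      using critical_line_functional_equation[of Q r lam mu z] param z by blast
    have "z \<in> S" using z \<theta> by (auto simp: S_def)
    note FGz = FG[OF this]
    define a where "a = A (of_nat p powr (- z))"
    define g where "g = cnj (\<kappa> * G z)"
    have "g \<noteq> 0" using \<kappa> \<open>G z \<noteq> 0\<close> by (simp add: g_def)
    have g: "\<kappa> * G z = \<omega>2 * g" using \<kappa>(2)[OF G(2)] unfolding g_def .
    have "a * (\<omega>2 * g) = \<kappa> * F z"
      unfolding g[symmetric] FGz a_def by simp
    also have "\<dots> = \<omega>1 * cnj (\<kappa> * F z)" by (rule \<kappa>(2)[OF F(2)])
    also have "\<dots> = \<omega>1 * cnj a * g" by (simp add: FGz a_def g_def)
    finally have "a * \<omega>2 = \<omega>1 * cnj a" using \<open>g \<noteq> 0\<close> by (simp add: mult.assoc[symmetric])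
    then show ?thesis
      using \<omega>(2) unfolding a_def[symmetric] \<tau>_def by (cases "\<omega>2 = 0") (auto simp: field_simps)
  qed
  \<comment> \<open>At zeros of \<open>G\<close> continuity is used: if the identity failed at
    \<open>z\<close>, it would fail nearby, so \<open>G\<close> would vanish on a segment of the
    critical line and hence at 2, where it is an exponential.\<close>
  have on_line': "A (of_nat p powr (- z)) = \<tau> * cnj (A (of_nat p powr (- z)))"
    if z: "Re z = 1 / 2" for z
  proof (rule ccontr)
    define D where "D z = A (of_nat p powr (- z)) - \<tau> * cnj (A (of_nat p powr (- z)))" for z
    assume "A (of_nat p powr (- z)) \<noteq> \<tau> * cnj (A (of_nat p powr (- z)))"
    then have Dz: "D z \<noteq> 0" by (simp add: D_def)
    have zS: "z \<in> S" using z \<theta> by (auto simp: S_def)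
    have contD: "continuous_on S D"
      unfolding D_def by (intro continuous_intros holomorphic_on_imp_continuous_on[OF holAS])
    then obtain e where e: "e > 0" "\<And>w. dist z w < e \<Longrightarrow> D w \<noteq> 0"
      using continuous_on_open_avoid[OF contD openS zS, of 0] Dz by blast
    have "G 2 = 0"
    proof (rule analytic_continuation[of G "- {1}" "{w. Re w = 1 / 2 \<and> dist z w < e}" z])
      show "G holomorphic_on - {1}" by (rule cond_IV_holomorphic[OF G(1)])
      show "connected (- {1 :: complex})"
        by (rule connected_punctured_universe) simp
      show "z islimpt {w. Re w = 1 / 2 \<and> dist z w < e}"
        unfolding islimpt_approachable
      proof (intro allI impI)
        fix d :: real assume d: "d > 0"
        define w where "w = z + \<i> * of_real (min d e / 2)"
        have "dist z w = min d e / 2"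
          using d e by (simp add: w_def dist_norm norm_mult)
        then show "\<exists>x'\<in>{w. Re w = 1 / 2 \<and> dist z w < e}. x' \<noteq> z \<and> dist x' z < d"
          using d e z by (intro bexI[of _ w]) (auto simp: dist_commute w_def)
      qed
      show "G w = 0" if "w \<in> {w. Re w = 1 / 2 \<and> dist z w < e}" for w
        using on_line[of w] e(2)[of w] that by (auto simp: D_def)
    qed (use z in auto)
    moreover have "G 2 = exp (twisted_log b2 (\<lambda>_. 1) 2)"
      using log_coeffs_exp[OF G(3), of 2] by simp
    ultimately show False by simp
  qed
  define \<rho> where "\<rho> = real p powr (- (1 / 2))"
  have \<rho>: "0 < \<rho>" "\<rho> < R"
    unfolding \<rho>_def R_def using p2 \<theta> by (auto intro!: powr_less_mono)
  have circle: "A q = \<tau> * cnj (A q)" if "norm q = \<rho>" for q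
  proof -
    \<comment> \<open>Every point of the circle is \<open>p powr (- z)\<close> for some
      \<open>z\<close> on the critical line.\<close>
    define z where "z = - Ln q / of_real (ln (real p))"
    have lp: "ln (real p) > 0" using p2 by simp
    have q0: "q \<noteq> 0" using that \<rho> by auto
    have "of_nat p powr (- z) = q"
      using p2 q0 lp by (simp add: powr_def z_def Ln_of_nat)
    moreover have "Re z = 1 / 2"
      using that lp q0 p2 by (simp add: z_def \<rho>_def ln_powr)
    ultimately show ?thesis using on_line'[of z] by simp
  qed
  \<comment> \<open>Dividing by a square root of the unimodular \<open>\<tau>\<close> turns
    \<open>A = \<tau> * cnj A\<close> into invariance under conjugation.\<close>
  define \<sigma> where "\<sigma> = csqrt \<tau>"
  have \<sigma>2: "\<sigma> * \<sigma> = \<tau>" by (simp add: \<sigma>_def flip: power2_eq_square)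
  have "norm \<sigma> * norm \<sigma> = 1"
    unfolding norm_mult[symmetric] \<sigma>2 using \<omega> by (simp add: \<tau>_def norm_divide)
  then have "\<sigma> * cnj \<sigma> = 1"
    by (simp add: complex_norm_square[symmetric] power2_eq_square flip: of_real_mult)
  then have \<sigma>: "\<sigma> \<noteq> 0" "inverse \<sigma> = cnj \<sigma>"
    by (auto intro: inverse_unique)
  have "A q / \<sigma> = A 0 / \<sigma>" if "norm q < \<rho>" for q
  proof (rule holomorphic_real_on_circle_imp_constant[of "\<lambda>q. A q / \<sigma>" R \<rho>])
    show "(\<lambda>q. A q / \<sigma>) holomorphic_on ball 0 R"
      using \<sigma> by (intro holomorphic_intros holA) auto
    fix q :: complex assume q: "norm q = \<rho>"
    have "A q / \<sigma> = \<sigma> * cnj (A q)"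
      by (subst circle[OF q]) (simp add: \<sigma>2[symmetric] \<sigma>(1))
    also have "\<dots> = cnj (A q / \<sigma>)"
      by (simp add: divide_inverse \<sigma>(2))
    finally show "Im (A q / \<sigma>) = 0"
      by (metis Reals_cnj_iff complex_is_Real_iff)
  qed (use \<rho> that in auto)
  then have A1: "A q = 1" if "norm q < \<rho>" for q
    using that A0 \<sigma> by simp
  have "norm (of_nat p powr (- s)) < \<rho>"
    unfolding np \<rho>_def using p2 s by (intro powr_less_mono) auto
  then show ?thesis
    using FG1[OF s] A1 by simp
qed

text \<open>Differentiating \<open>exp (g q) = 1\<close> gives \<open>deriv g = 0\<close>. Equal
  exponentials of two local logarithms therefore force the logarithms to agree, as both vanish at
  0.\<close>

lemma exp_eq_1_imp_eq_0:
  fixes g :: "complex \<Rightarrow> complex"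
  assumes hol: "g holomorphic_on ball 0 R" and "R > 0" and one: "\<And>q. q \<in> ball 0 R \<Longrightarrow> exp (g q) = 1"
    and "g 0 = 0" and q: "q \<in> ball 0 R"
  shows "g q = 0"
proof -
  have d0: "(g has_field_derivative 0) (at x within ball 0 R)" if x: "x \<in> ball 0 R" for x
  proof -
    have g: "(g has_field_derivative deriv g x) (at x)"
      using hol x by (simp add: holomorphic_derivI)
    then have "((\<lambda>q. exp (g q)) has_field_derivative exp (g x) * deriv g x) (at x)"
      by (auto intro!: derivative_eq_intros)
    moreover have "((\<lambda>q. exp (g q)) has_field_derivative 0) (at x)"
      by (rule has_field_derivative_transform_within_open[OF DERIV_const open_ball x]) (use one in auto)
    ultimately have "exp (g x) * deriv g x = 0"
      by (rule DERIV_unique)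
    with g show ?thesis
      by (simp add: has_field_derivative_at_within)
  qed
  then obtain c where "\<And>x. x \<in> ball 0 R \<Longrightarrow> g x = c"
    using has_field_derivative_zero_constant[OF convex_ball d0] by blast
  then show ?thesis
    using q \<open>R > 0\<close> \<open>g 0 = 0\<close> by (metis centre_in_ball)
qed

text \<open>The second alternative of the dichotomy would give \<open>F1 = F2\<close>, because
  functions that differ in one Euler factor only are equal. So the first alternative holds at every
  prime, all local factors of \<open>F1\<close> and \<open>F2\<close> agree, and again
  \<open>F1 = F2\<close>.\<close>

lemma no_linear_relation:
  assumes param: "Q > 0" "\<And>j. j \<in> {1..r} \<Longrightarrow> lam j > 0" "\<And>j. j \<in> {1..r} \<Longrightarrow> Re (mu j) \<ge> 0"
    and IV: "cond_IV F1" "cond_IV F2" and V: "cond_V r Q lam mu \<omega>1 F1" "cond_V r Q lam mu \<omega>2 F2"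
    and II: "cond_II F1" "cond_II F2" "cond_II F3"
    and distinct: "\<exists>s. Re s > 1 \<and> F1 s \<noteq> F2 s" "\<exists>s. Re s > 1 \<and> F1 s \<noteq> F3 s" "\<exists>s. Re s > 1 \<and> F2 s \<noteq> F3 s"
    and rel: "\<And>s. Re s > 1 \<Longrightarrow> F3 s = \<alpha> * F1 s + \<beta> * F2 s"
  shows False
proof -
  obtain b1 b2 b3 where b: "log_coeffs F1 b1" "log_coeffs F2 b2" "log_coeffs F3 b3"
    using II cond_II_log_coeffs by metis
  \<comment> \<open>All three functions tend to 1 far to the right, so
    \<open>\<alpha> + \<beta> = 1\<close>. If one coefficient were 0, \<open>F3\<close> would equal
    \<open>F1\<close> or \<open>F2\<close>.\<close>
  have "(\<lambda>n. \<alpha> * F1 (of_nat (n + 2)) + \<beta> * F2 (of_nat (n + 2))) \<longlonglongrightarrow> \<alpha> * 1 + \<beta> * 1"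
    by (intro tendsto_intros log_coeffs_tendsto_1[OF b(1)] log_coeffs_tendsto_1[OF b(2)])
  also have "(\<lambda>n. \<alpha> * F1 (of_nat (n + 2)) + \<beta> * F2 (of_nat (n + 2))) = (\<lambda>n. F3 (of_nat (n + 2)))"
    by (intro ext rel[symmetric]) simp
  finally have sum1: "1 = \<alpha> + \<beta>"
    using LIMSEQ_unique[OF log_coeffs_tendsto_1[OF b(3)]] by simp
  have nz: "\<alpha> \<noteq> 0" "\<beta> \<noteq> 0"
  proof -
    show "\<alpha> \<noteq> 0"
    proof
      assume "\<alpha> = 0"
      then have "F3 s = F2 s" if "Re s > 1" for s
        using rel[OF that] sum1 by simp
      with distinct(3) show False by metis
    qed
    show "\<beta> \<noteq> 0"
    proof
      assume "\<beta> = 0"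
      then have "F3 s = F1 s" if "Re s > 1" for s
        using rel[OF that] sum1 by simp
      with distinct(2) show False by metis
    qed
  qed
  have no_away: "\<not> (\<forall>s. Re s > 1 \<longrightarrow> exp (away_log b1 p s) = exp (away_log b2 p s))" if p: "prime p" for p
  proof
    assume *: "\<forall>s. Re s > 1 \<longrightarrow> exp (away_log b1 p s) = exp (away_log b2 p s)"
    have "F1 s = F2 s" if "Re s > 1" for s
      by (rule eq_if_differing_in_one_local_factor
          [OF param(1) _ _ IV(1) V(1) b(1) IV(2) V(2) b(2) p _ that]) (use param * in simp_all)
    with distinct(1) show False by metis
  qed
  have loc: "local_log b1 p q = local_log b2 p q" if p: "prime p" and q: "q \<in> ball 0 (real p powr (- (1 / 2)))" for p q
  proof -
    have "(\<forall>q\<in>ball 0 (real p powr (- (1 / 2))). exp (local_log b1 p q) = exp (local_log b2 p q)) \<or>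
        (\<forall>s. Re s > 1 \<longrightarrow> exp (away_log b1 p s) = exp (away_log b2 p s))"
      by (rule linear_relation_dichotomy[OF b _ nz p]) (rule rel)
    then have eq: "exp (local_log b1 p q) = exp (local_log b2 p q)" if "q \<in> ball 0 (real p powr (- (1 / 2)))" for q
      using no_away[OF p] that by metis
    have "local_log b1 p q - local_log b2 p q = 0"
    proof (rule exp_eq_1_imp_eq_0[of "\<lambda>q. local_log b1 p q - local_log b2 p q", OF _ _ _ _ q])
      show "(\<lambda>q. local_log b1 p q - local_log b2 p q) holomorphic_on ball 0 (real p powr (- (1 / 2)))"
        by (intro holomorphic_intros local_log_holomorphic[OF b(1) p] local_log_holomorphic[OF b(2) p])
      show "exp (local_log b1 p q - local_log b2 p q) = 1" if "q \<in> ball 0 (real p powr (- (1 / 2)))" for q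
        using eq[OF that] by (simp add: exp_diff)
    qed (use prime_gt_0_nat[OF p] in \<open>auto simp: local_log_0\<close>)
    then show ?thesis by simp
  qed
  have "F1 s = F2 s" if s: "Re s > 1" for s
  proof -
    have "local_log b1 p (of_nat p powr (- s)) = local_log b2 p (of_nat p powr (- s))" if p: "prime p" for p
      by (rule loc[OF p])
        (use s prime_ge_2_nat[OF p] in \<open>auto simp: norm_powr_real_powr intro!: powr_less_mono\<close>)
    then have "twisted_log b1 (\<lambda>_. 1) s = twisted_log b2 (\<lambda>_. 1) s"
      unfolding twisted_log_eq_sum_local_log[OF b(1) s] twisted_log_eq_sum_local_log[OF b(2) s]
      by (intro infsum_cong) simp
    then show ?thesis
      using log_coeffs_exp[OF b(1) s] log_coeffs_exp[OF b(2) s] by simp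
  qed
  with distinct(1) show False by metis
qed

section \<open>Zero-free strips\<close>

lemma cond_II_tendsto_1:
  assumes "cond_II F"
  shows "(\<lambda>n. F (of_nat (n + 2))) \<longlonglongrightarrow> 1"
  using cond_II_log_coeffs[OF assms] log_coeffs_tendsto_1 by blast

lemma has_sum_finite_sum:
  fixes f :: "'i \<Rightarrow> 'a \<Rightarrow> 'b :: topological_comm_monoid_add"
  assumes "finite J" "\<And>j. j \<in> J \<Longrightarrow> (f j has_sum S j) A"
  shows "((\<lambda>x. \<Sum>j\<in>J. f j x) has_sum (\<Sum>j\<in>J. S j)) A"
  using assms by (induction J) (auto intro: has_sum_add)

lemma cond_I_lincomb:
  fixes F :: "'n::finite \<Rightarrow> complex \<Rightarrow> complex" and c :: "complex ^ 'n"
  assumes "\<And>j. cond_I (F j) (a j)"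
  shows "cond_I (lincomb c F) (lincomb c a)"
  unfolding cond_I_def
proof (intro allI impI)
  fix s :: complex assume s: "Re s > 1"
  have conv: "(\<lambda>n. norm (dirichlet_term (a j) s n)) summable_on {1..}"
    and F: "F j s = infsum (dirichlet_term (a j) s) {1..}" for j
    using assms[of j] s unfolding cond_I_def dirichlet_abs_conv_def dirichlet_series_def by auto
  have lin: "dirichlet_term (lincomb c a) s = (\<lambda>n. \<Sum>j\<in>UNIV. c $ j * dirichlet_term (a j) s n)"
    by (rule ext) (simp add: dirichlet_term_def lincomb_def sum_distrib_right mult.assoc)
  have "(\<lambda>n. \<Sum>j\<in>UNIV. norm (c $ j) * norm (dirichlet_term (a j) s n)) summable_on {1..}"
  proof (rule has_sum_imp_summable[OF has_sum_finite_sum])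
    show "((\<lambda>n. norm (c $ j) * norm (dirichlet_term (a j) s n)) has_sum
        (norm (c $ j) * infsum (\<lambda>n. norm (dirichlet_term (a j) s n)) {1..})) {1..}" for j
      by (intro has_sum_cmult_right has_sum_infsum conv)
  qed simp
  then have "dirichlet_abs_conv (lincomb c a) s"
    unfolding dirichlet_abs_conv_def lin
    by (rule summable_on_comparison_test) (auto intro!: sum_norm_le simp: norm_mult)
  moreover have "((\<lambda>n. \<Sum>j\<in>UNIV. c $ j * dirichlet_term (a j) s n) has_sum (\<Sum>j\<in>UNIV. c $ j * F j s)) {1..}"
  proof (rule has_sum_finite_sum)
    show "((\<lambda>n. c $ j * dirichlet_term (a j) s n) has_sum c $ j * F j s) {1..}" for j
      unfolding F by (rule has_sum_cmult_right[OF has_sum_infsum[OF abs_summable_summable[OF conv]]])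
  qed simp
  ultimately show "dirichlet_abs_conv (lincomb c a) s \<and> lincomb c F s = dirichlet_series (lincomb c a) s"
    unfolding dirichlet_series_def lin lincomb_def[of c F] by (simp add: infsumI)
qed

lemma sigma_star_ge_zero:
  assumes "cond_I L a" "Re s > 1" "L s = 0"
  shows "ereal (Re s) \<le> sigma_star a"
proof -
  \<comment> \<open>Convergence strictly to the left of \<open>s\<close> is needed, as
    \<open>sigma_star\<close> counts only zeros strictly beyond the abscissa.\<close>
  define x where "x = (1 + Re s) / 2"
  have x: "x > 1" "x < Re s" using assms(2) by (auto simp: x_def)
  have "dirichlet_abs_conv a (of_real x)"
    using assms(1) x(1) unfolding cond_I_def by simp
  then have "abs_conv_abscissa a \<le> ereal x"
    unfolding abs_conv_abscissa_def by (intro Inf_lower) blast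
  also have "\<dots> < ereal (Re s)" using x by simp
  finally have "abs_conv_abscissa a < ereal (Re s)" .
  moreover have "dirichlet_series a s = 0"
    using assms unfolding cond_I_def by auto
  ultimately show ?thesis
    unfolding sigma_star_def by (intro Sup_upper) blast
qed

lemma cond_I_leading_term:
  assumes "cond_I L a" "N \<ge> 1" "\<And>n. 1 \<le> n \<Longrightarrow> n < N \<Longrightarrow> a n = 0"
  obtains K where "K \<ge> 0"
    "\<And>s. Re s \<ge> 2 \<Longrightarrow> norm (L s - a N * of_nat N powr (- s)) \<le> K * real (N + 1) powr (- Re s)"
proof -
  have conv: "dirichlet_abs_conv a (of_real 2)"
    using assms(1) unfolding cond_I_def by simp
  obtain K where K: "K \<ge> 0"
    "\<And>s. Re s \<ge> 2 \<Longrightarrow> norm (dirichlet_series a s - a N * of_nat N powr (- s)) \<le> K * real (N + 1) powr (- Re s)"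
    using dirichlet_series_leading_term[OF conv assms(2)] assms(3) by blast
  show thesis
    by (rule that[OF K(1)]) (use K(2) assms(1) in \<open>auto simp: cond_I_def\<close>)
qed

text \<open>\<open>F (n + 2)\<close> tends to \<open>a 1\<close> by the Dirichlet series and to 1 by
  the Euler product.\<close>

lemma first_coefficient_eq_1:
  assumes "cond_I F a" "cond_II F"
  shows "a 1 = 1"
proof -
  obtain K where K: "\<And>s. Re s \<ge> 2 \<Longrightarrow> norm (F s - a 1 * of_nat 1 powr (- s)) \<le> K * real (1 + 1) powr (- Re s)"
    using cond_I_leading_term[OF assms(1), of 1] by auto
  have "filterlim (\<lambda>n. real (n + 2)) at_top sequentially"
    by (rule filterlim_compose[OF filterlim_real_sequentially filterlim_add_const_nat_at_top])
  then have "(\<lambda>n. (1 / 2 :: real) powr real (n + 2)) \<longlonglongrightarrow> 0"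
    by (intro filterlim_compose[OF powr_at_top_tendsto_0]) auto
  then have lim: "(\<lambda>n. K * (1 / 2) powr real (n + 2)) \<longlonglongrightarrow> 0"
    by (rule tendsto_mult_right_zero)
  have bound: "norm (F (of_nat (n + 2)) - a 1) \<le> K * (1 / 2) powr real (n + 2)" for n
  proof -
    have "(1 / 2 :: real) powr x = 2 powr (- x)" for x
      by (simp add: powr_minus powr_divide divide_simps)
    then show ?thesis
      using K[of "of_nat (n + 2)"] by simp
  qed
  have "(\<lambda>n. F (of_nat (n + 2)) - a 1) \<longlonglongrightarrow> 0"
    by (rule Lim_null_comparison[OF _ lim]) (use bound in auto)
  then have "(\<lambda>n. F (of_nat (n + 2))) \<longlonglongrightarrow> a 1"
    by (simp add: LIM_zero_iff)
  then show ?thesis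
    using LIMSEQ_unique[OF _ cond_II_tendsto_1[OF assms(2)]] by blast
qed

text \<open>Cramer's rule, the hypothesis being a nonzero determinant.\<close>

lemma real_span_of_two_complex:
  fixes u w v :: complex
  assumes "Re u * Im w - Im u * Re w \<noteq> 0"
  obtains x y :: real where "v = of_real x * u + of_real y * w"
proof -
  define D A B where "D = Re u * Im w - Im u * Re w"
    and "A = Re v * Im w - Im v * Re w" and "B = Re u * Im v - Im u * Re v"
  have D: "D \<noteq> 0" using assms by (simp add: D_def)
  have "D * Re v = A * Re u + B * Re w" "D * Im v = A * Im u + B * Im w"
    by (simp_all add: D_def A_def B_def algebra_simps)
  then have "v = of_real (A / D) * u + of_real (B / D) * w"
    using D by (simp add: complex_eq_iff field_simps)
  then show thesis by (rule that)
qed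

text \<open>The expression is the imaginary part of \<open>cnj \<eta>1 * \<eta>2\<close>. If it
  vanished, this unimodular number would be 1 or -1, so \<open>\<eta>1\<close> and
  \<open>\<eta>2\<close> would have equal squares and the root numbers would coincide.\<close>

lemma conj_sqrt_not_real_multiple:
  fixes \<omega>1 \<omega>2 :: complex
  assumes \<eta>: "\<eta>1 * \<eta>1 * \<omega>1 = 1" "\<eta>2 * \<eta>2 * \<omega>2 = 1" "norm \<eta>1 = 1" "norm \<eta>2 = 1" and "\<omega>1 \<noteq> \<omega>2"
  shows "Re \<eta>1 * Im \<eta>2 - Im \<eta>1 * Re \<eta>2 \<noteq> 0"
proof
  define z where "z = cnj \<eta>1 * \<eta>2"
  assume "Re \<eta>1 * Im \<eta>2 - Im \<eta>1 * Re \<eta>2 = 0"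
  then have "Im z = 0" by (simp add: z_def)
  moreover have "norm z = 1" using \<eta> by (simp add: z_def norm_mult)
  ultimately have "z = 1 \<or> z = - 1"
    by (auto simp: complex_eq_iff cmod_def)
  then have zz: "z * z = 1" by auto
  have c: "\<eta>1 * cnj \<eta>1 = 1"
    using \<eta>(3) by (simp add: complex_norm_square[symmetric])
  then have "\<eta>1 * z = \<eta>2" by (simp add: z_def flip: mult.assoc)
  then have "\<eta>2 * \<eta>2 = \<eta>1 * \<eta>1 * (z * z)" by (simp add: mult_ac flip: \<open>\<eta>1 * z = \<eta>2\<close>)
  then have "\<eta>1 * \<eta>1 * \<omega>2 = 1" using \<eta>(2) zz by simp
  then show False
    using \<eta>(1) \<open>\<omega>1 \<noteq> \<omega>2\<close> by (metis mult_left_cancel mult_zero_left zero_neq_one)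
qed

text \<open>The index type stands for the numbers from 1 to N. \<open>distinct_functions\<close>
  says that there are N different functions; they are compared for \<open>Re s > 1\<close> since the
  value at 1 is arbitrary. That \<open>\<omega>'\<close> has modulus 1 is part of
  \<open>cond_V\<close>.\<close>

theorem theorem6:
  fixes F :: "'n::finite \<Rightarrow> complex \<Rightarrow> complex"
    and a :: "'n \<Rightarrow> nat \<Rightarrow> complex"
    and \<omega> :: "'n \<Rightarrow> complex"
    and r :: nat and Q :: real and lam :: "nat \<Rightarrow> real" and mu :: "nat \<Rightarrow> complex"
  assumes "CARD('n) \<ge> 3"
    and "Q > 0"
    and "\<And>j. j \<in> {1..r} \<Longrightarrow> lam j > 0"
    and "\<And>j. j \<in> {1..r} \<Longrightarrow> Re (mu j) \<ge> 0"
    and "\<And>j. cond_I (F j) (a j)"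
    and "\<And>j. cond_II (F j)"
    and "\<And>j. cond_IV (F j)"
    and "\<And>j. cond_V r Q lam mu (\<omega> j) (F j)"
    and distinct_functions: "\<And>h k. h \<noteq> k \<Longrightarrow> \<exists>s. Re s > 1 \<and> F h s \<noteq> F k s"
    and "\<exists>h k. \<omega> h \<noteq> \<omega> k"
  shows "infinite {c :: complex ^ 'n.
           cond_IV (lincomb c F) \<and>
           (\<exists>\<omega>'. cond_V r Q lam mu \<omega>' (lincomb c F)) \<and>
           (\<exists>\<sigma>1 \<sigma>2. 1 < \<sigma>1 \<and> \<sigma>1 < \<sigma>2 \<and> ereal \<sigma>2 < sigma_star (lincomb c a) \<and>
              (\<forall>s. \<sigma>1 < Re s \<and> Re s < \<sigma>2 \<longrightarrow> lincomb c F s \<noteq> 0))}"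
proof -
  obtain h k where hk: "\<omega> h \<noteq> \<omega> k" using assms(10) by blast
  have "card {h, k} \<le> 2" by (simp add: card_insert_if)
  then have "{h, k} \<noteq> UNIV" using assms(1) by (metis Suc_n_not_le_n eval_nat_numeral(3) order_trans)
  then obtain m where m: "m \<noteq> h" "m \<noteq> k" by blast
  have "h \<noteq> k" using hk by auto
  \<comment> \<open>Since \<open>\<eta> j * \<omega> j = cnj (\<eta> j)\<close>, every real multiple
    of \<open>\<eta> j\<close> meets the coefficient condition of \<open>cond_V_lincomb\<close> with
    root number 1.\<close>
  define \<eta> where "\<eta> j = cnj (csqrt (\<omega> j))" for j
  have norm\<omega>: "norm (\<omega> j) = 1" for j
    using assms(8)[of j] by (simp add: cond_V_def)
  have norm\<eta>: "norm (\<eta> j) = 1" for j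
    by (simp add: \<eta>_def norm\<omega>)
  have \<eta>cnj: "\<eta> j * cnj (\<eta> j) = 1" for j
    using norm\<eta>[of j] by (simp add: complex_norm_square[symmetric])
  have \<eta>\<omega>: "\<eta> j * \<omega> j = cnj (\<eta> j)" for j
  proof -
    have "\<omega> j = cnj (\<eta> j) * cnj (\<eta> j)"
      by (simp add: \<eta>_def flip: power2_eq_square)
    then show ?thesis using \<eta>cnj[of j] by (simp flip: mult.assoc)
  qed
  \<comment> \<open>The third function gets coefficient \<open>\<eta> m\<close>, which keeps
    \<open>c0\<close> nonzero, and the other two balance it.\<close>
  obtain x y :: real where xy: "- \<eta> m = of_real x * \<eta> h + of_real y * \<eta> k"
  proof (rule real_span_of_two_complex)
    show "Re (\<eta> h) * Im (\<eta> k) - Im (\<eta> h) * Re (\<eta> k) \<noteq> 0"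
      by (rule conj_sqrt_not_real_multiple[of _ "\<omega> h" _ "\<omega> k"])
        (use hk norm\<eta> in \<open>simp_all add: mult.assoc \<eta>\<omega> \<eta>cnj\<close>)
  qed
  have sum0: "of_real x * \<eta> h + of_real y * \<eta> k + \<eta> m = 0"
    unfolding xy[symmetric] by simp
  define x0 :: "'n \<Rightarrow> real" where "x0 j = (if j = h then x else if j = k then y else if j = m then 1 else 0)" for j
  define c0 :: "complex ^ 'n" where "c0 = (\<chi> j. of_real (x0 j) * \<eta> j)"
  have lin0: "lincomb c0 f t = of_real x * \<eta> h * f h t + of_real y * \<eta> k * f k t + \<eta> m * f m t"
    for f :: "'n \<Rightarrow> 'b \<Rightarrow> complex" and t
  proof -
    have "lincomb c0 f t = (\<Sum>j\<in>{h, k, m}. of_real (x0 j) * \<eta> j * f j t)"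
      unfolding lincomb_def c0_def
      by (rule sum.mono_neutral_cong_right) (auto simp: x0_def)
    then show ?thesis
      using m \<open>h \<noteq> k\<close> by (simp add: x0_def)
  qed
  have I0: "cond_I (lincomb c0 F) (lincomb c0 a)"
    by (rule cond_I_lincomb) (rule assms(5))
  have a1: "a j 1 = 1" for j
    by (rule first_coefficient_eq_1[OF assms(5,6)])
  \<comment> \<open>Otherwise the combination vanishes for \<open>Re s > 1\<close>, and solving for
    \<open>F m\<close> contradicts \<open>no_linear_relation\<close>.\<close>
  have ex: "\<exists>n\<ge>1. lincomb c0 a n \<noteq> 0"
  proof (rule ccontr)
    assume "\<not> (\<exists>n\<ge>1. lincomb c0 a n \<noteq> 0)"
    then have "dirichlet_series (lincomb c0 a) s = 0" for s
      unfolding dirichlet_series_def by (intro infsum_0) (auto simp: dirichlet_term_def)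
    then have L0: "lincomb c0 F s = 0" if "Re s > 1" for s
      using I0 that unfolding cond_I_def by auto
    have rel: "F m s = - (of_real x * \<eta> h * cnj (\<eta> m)) * F h s + - (of_real y * \<eta> k * cnj (\<eta> m)) * F k s"
      if "Re s > 1" for s
    proof -
      have "F m s = \<eta> m * cnj (\<eta> m) * F m s" by (simp add: \<eta>cnj)
      also have "\<dots> = cnj (\<eta> m) * (\<eta> m * F m s)" by (simp add: mult_ac)
      also have "\<eta> m * F m s = - (of_real x * \<eta> h * F h s + of_real y * \<eta> k * F k s)"
        using L0[OF that] unfolding lin0 by (simp add: add_eq_0_iff)
      finally show ?thesis by (simp add: algebra_simps)
    qed
    show False
    proof (rule no_linear_relation[OF assms(2-4) assms(7)[of h] assms(7)[of k]
        assms(8)[of h] assms(8)[of k] assms(6)[of h] assms(6)[of k] assms(6)[of m]])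
      fix s :: complex assume "Re s > 1"
      then show "F m s = - (of_real x * \<eta> h * cnj (\<eta> m)) * F h s + - (of_real y * \<eta> k * cnj (\<eta> m)) * F k s"
        by (rule rel)
    qed (use distinct_functions[of h k] distinct_functions[of h m] distinct_functions[of k m] \<open>h \<noteq> k\<close> m in auto)
  qed
  define q where "q = (LEAST n. n \<ge> 1 \<and> lincomb c0 a n \<noteq> 0)"
  have q: "q \<ge> 1" "lincomb c0 a q \<noteq> 0"
    using LeastI_ex[OF ex[unfolded Bex_def]] unfolding q_def by auto
  have before_q: "lincomb c0 a n = 0" if "1 \<le> n" "n < q" for n
    using not_less_Least[of n "\<lambda>n. n \<ge> 1 \<and> lincomb c0 a n \<noteq> 0"] that unfolding q_def by auto
  \<comment> \<open>Every \<open>a j 1\<close> is 1, so this coefficient is the sum of the entries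
    of \<open>c0\<close>.\<close>
  have "lincomb c0 a 1 = 0"
    unfolding lin0 a1 using sum0 by simp
  with q have "q \<ge> 2" by (cases "q = 1") auto
  obtain K1 where K1: "K1 \<ge> 0" "\<And>s. Re s \<ge> 2 \<Longrightarrow>
      norm (lincomb c0 F s - lincomb c0 a q * of_nat q powr (- s)) \<le> K1 * real (q + 1) powr (- Re s)"
    using cond_I_leading_term[OF I0 q(1) before_q] by blast
  obtain K2 where K2: "K2 \<ge> 0" "\<And>s. Re s \<ge> 2 \<Longrightarrow>
      norm (F h s - a h 1 * of_nat 1 powr (- s)) \<le> K2 * real (1 + 1) powr (- Re s)"
    using cond_I_leading_term[OF assms(5)[of h], of 1] by auto
  define K where "K = max K1 K2"
  have hol: "lincomb c0 F holomorphic_on {s. Re s > 1}" "F h holomorphic_on {s. Re s > 1}"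
    by (auto intro!: holomorphic_on_subset[OF cond_IV_holomorphic] cond_IV_lincomb assms(7))
  have f: "norm (lincomb c0 F s - lincomb c0 a q * of_nat q powr (- s)) \<le> K * real (q + 1) powr (- Re s)"
    if "Re s \<ge> 2" for s
    by (rule order_trans[OF K1(2)[OF that]]) (auto simp: K_def intro!: mult_right_mono)
  have g: "norm (F h s - 1) \<le> K * 2 powr (- Re s)" if "Re s \<ge> 2" for s
  proof -
    have "norm (F h s - 1) \<le> K2 * 2 powr (- Re s)"
      using K2(2)[OF that] a1[of h] by simp
    also have "\<dots> \<le> K * 2 powr (- Re s)"
      by (auto simp: K_def intro!: mult_right_mono)
    finally show ?thesis .
  qed
  have "K \<ge> 0" using K1(1) by (simp add: K_def)
  obtain \<sigma>1 \<sigma>2 \<delta>0 where \<sigma>: "1 < \<sigma>1" "\<sigma>1 < \<sigma>2" "\<delta>0 > 0"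
    and nz: "\<And>(e::complex) s. 0 < norm e \<Longrightarrow> norm e < \<delta>0 \<Longrightarrow> \<sigma>1 < Re s \<Longrightarrow> Re s < \<sigma>2 \<Longrightarrow>
      lincomb c0 F s + e * F h s \<noteq> 0"
    and zero: "\<And>(e::complex). 0 < norm e \<Longrightarrow> norm e < \<delta>0 \<Longrightarrow>
      \<exists>s. Re s > \<sigma>2 \<and> lincomb c0 F s + e * F h s = 0"
    using perturbed_zero_free_strip_and_zero[OF q(2) \<open>q \<ge> 2\<close> \<open>K \<ge> 0\<close> f g hol] by blast
  \<comment> \<open>Only the entry at \<open>h\<close> moves, and by a real multiple of
    \<open>\<eta> h\<close>, so the root number 1 is kept. The perturbation parameter is
    \<open>e = \<delta> * \<eta> h\<close>.\<close>
  define c :: "real \<Rightarrow> complex ^ 'n" where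
    "c \<delta> = (\<chi> j. of_real (x0 j + (if j = h then \<delta> else 0)) * \<eta> j)" for \<delta>
  have c_split: "c \<delta> $ j = c0 $ j + (if j = h then of_real \<delta> * \<eta> h else 0)" for \<delta> j
    by (simp add: c_def c0_def algebra_simps)
  have linc: "lincomb (c \<delta>) F s = lincomb c0 F s + of_real \<delta> * \<eta> h * F h s" for \<delta> s
    unfolding lincomb_def c_split by (simp add: distrib_right sum.distrib if_distrib[of "\<lambda>x. x * _"] sum.delta cong: if_cong)
  have inj: "inj_on c {0<..<\<delta>0}"
  proof (rule inj_onI)
    fix \<delta> \<delta>' assume "c \<delta> = c \<delta>'"
    then have "c \<delta> $ h = c \<delta>' $ h" by simp
    then show "\<delta> = \<delta>'" using norm\<eta>[of h] by (auto simp: c_split)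
  qed
  have "infinite (c ` {0<..<\<delta>0})"
    using \<open>\<delta>0 > 0\<close> finite_imageD[OF _ inj] infinite_Ioo by blast
  moreover have "c ` {0<..<\<delta>0} \<subseteq> {c :: complex ^ 'n.
           cond_IV (lincomb c F) \<and>
           (\<exists>\<omega>'. cond_V r Q lam mu \<omega>' (lincomb c F)) \<and>
           (\<exists>\<sigma>1 \<sigma>2. 1 < \<sigma>1 \<and> \<sigma>1 < \<sigma>2 \<and> ereal \<sigma>2 < sigma_star (lincomb c a) \<and>
              (\<forall>s. \<sigma>1 < Re s \<and> Re s < \<sigma>2 \<longrightarrow> lincomb c F s \<noteq> 0))}"
  proof (intro subsetI CollectI, elim imageE, intro conjI)
    fix v \<delta> assume v: "v = c \<delta>" and "\<delta> \<in> {0<..<\<delta>0}"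
    then have \<delta>: "0 < norm (of_real \<delta> * \<eta> h)" "norm (of_real \<delta> * \<eta> h) < \<delta>0"
      using norm\<eta>[of h] by (auto simp: norm_mult)
    show "cond_IV (lincomb v F)"
      by (rule cond_IV_lincomb) (rule assms(7))
    have "cond_V r Q lam mu 1 (lincomb v F)"
      by (rule cond_V_lincomb[where \<omega> = \<omega>])
        (use assms(8) in \<open>auto simp: v c_def mult.assoc \<eta>\<omega>\<close>)
    then show "\<exists>\<omega>'. cond_V r Q lam mu \<omega>' (lincomb v F)" ..
    obtain s where s: "Re s > \<sigma>2" "lincomb v F s = 0"
      using zero[OF \<delta>] unfolding v linc by blast
    have "ereal \<sigma>2 < ereal (Re s)" using s by simp
    also have "ereal (Re s) \<le> sigma_star (lincomb v a)"
      by (rule sigma_star_ge_zero[OF cond_I_lincomb[of F a, OF assms(5)]]) (use s \<sigma> in auto)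
    finally show "\<exists>\<sigma>1 \<sigma>2. 1 < \<sigma>1 \<and> \<sigma>1 < \<sigma>2 \<and> ereal \<sigma>2 < sigma_star (lincomb v a) \<and>
              (\<forall>s. \<sigma>1 < Re s \<and> Re s < \<sigma>2 \<longrightarrow> lincomb v F s \<noteq> 0)"
      using \<sigma>(1,2) nz[OF \<delta>] unfolding v linc by blast
  qed
  ultimately show ?thesis
    using infinite_super by blast
qed

end
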